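(* Let $i\in\mathbb Z$, $a\in\mathbb A_i$ and $X$ an internal predicate. Then $[\![\forall[a]X]\!]=\bigcap_{x\in\mathcal L_i}[\![X[a\mapsto x]]\!]$, where $[\![Y]\!]$ denotes the set of points $p$ with $p\models Y$.
   Context: Atoms: for each $i\in\mathbb Z$ a set $\mathbb A_i$ of atoms (pairwise disjoint, each of cardinality $\beth_\omega$ where $\beth_0=|\mathbb N|$, $\beth_{l+1}=2^{\beth_l}$, $\beth_\omega=\sup_l\beth_l$). Small = cardinality $<\beth_\omega$; generous = cardinality $\beth_\omega$; $\mathsf N a'\in\mathbb A_i.\Phi(a')$ means $\{a'\in\mathbb A_i:\Phi(a')\}$ has small complement in $\mathbb A_i$. $(a\,b)$ swaps atoms of equal level. Internal syntax (binders $[a]$ up to $\alpha$-equivalence): internal predicates $\wedge(\mathcal X)$ ($\mathcal X$ finite), $\neg X$, $\forall[a]X$, $\in(x,a)$ with $a\in\mathbb A_{i+1}$, $x\in\mathcal L_i$; internal sets of level $i$ ($\mathcal L_i$): $\mathrm{atm}(a)$ ($a\in\mathbb A_i$), $[a]X$ ($a\in\mathbb A_{i-1}$). $a\#Z$: $a$ not free in $Z$; $x@b=(b\,a)\cdot X$ for $x=[a]X$, $b$ fresh. Substitution $Z[a\mapsto x]$ ($a\in\mathbb A_i$, $x\in\mathcal L_i$): $\wedge(\mathcal X)[a\mapsto x]=\wedge\{X[a\mapsto x]\}$; $(\neg X)[a\mapsto x]=\neg(X[a\mapsto x])$; $(\forall[b]X)[a\mapsto x]=\forall[b](X[a\mapsto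 x])$ for $b\#x$; $\in(y,a)[a\mapsto\mathrm{atm}(n)]=\in(y[a\mapsto\mathrm{atm}(n)],n)$; $\in(y,a)[a\mapsto[a']X]=X[a'\mapsto y[a\mapsto[a']X]]$ ($a'$ fresh); $\in(y,b)[a\mapsto x]=\in(y[a\mapsto x],b)$ for $b\ne a$; $\mathrm{atm}(a)[a\mapsto x]=x$; $\mathrm{atm}(b)[a\mapsto x]=\mathrm{atm}(b)$; $([c]X)[a\mapsto x]=[c](X[a\mapsto x])$ for $c\#x$ (well defined). Prepoints: subsets $p$ of $\bigcup_i\mathbb A_i\times\mathcal L_{i-1}$ (elements $a\triangleright y$). Validity: $p\models\wedge(\mathcal X)$ iff all $p\models X$; $p\models\neg X$ iff not $p\models X$; $p\models\forall[a]X$ iff $\mathsf N a'\in\mathbb A_{\mathrm{level}(a)}.\,p\models(a'\,a)\cdot X$; $p\models\in(y,a)$ iff $a\triangleright y\in p$. $y\mathrel{\dot\in}x$ is $(x@b)[b\mapsto y]$ for a comprehension $x$ ($b$ fresh), and $\in(y,a)$ for $x=\mathrm{atm}(a)$; $p(x)=\{y:p\models y\mathrel{\dot\in}x\}$. $p\models_{ext}u=u'$ iff $p(u)=p(u')$; $p\models_{int}u=u'$ ($u,u'\in\mathcal L_i$) iff for all $j$, $b\in\mathbb A_{j+1}$, $c\in\mathbb A_i$, $y\in\mathcal L_j$: $b\triangleright y[c\mapsto u]\in p\iff b\triangleright y[c\mapsto u']\in p$. Points: $p$ generously names $x\in\mathcal L_i$ if for every $a\in\mathbb A_i$ and internal predicate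 $X$ the set $\{a'\in\mathbb A_i:p\models(a'\,a)\cdot X\iff p\models X[a\mapsto x]\}$ is generous. $p$ is extensional if $p\models_{ext}x=x'$ implies $p\models_{int}x=x'$ for all $x,x'$ of equal level. A shift permutation is a bijection $\vartheta$ of atoms with $\vartheta(\mathbb A_i)=\mathbb A_{i+1}$ for all $i$, acting on prepoints by $\vartheta\cdot p=\{\vartheta(a)\triangleright\vartheta\cdot x:a\triangleright x\in p\}$ (renaming atoms in syntax); $p$ is ambiguous if $\vartheta\cdot p=p$ for some shift permutation. A point is a prepoint that is extensional, ambiguous and generously names every internal set. *)

theory Defs
  imports "HOL-Library.FSet" "HOL-Library.Equipollence" "HOL-Combinatorics.Transposition"
begin

fun is_beth :: "nat \<Rightarrow> 'a set \<Rightarrow> bool" where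
  "is_beth 0 S \<longleftrightarrow> S \<approx> (UNIV :: nat set)"
| "is_beth (Suc l) S \<longleftrightarrow> (\<exists>T :: 'a set. is_beth l T \<and> S \<approx> Pow T)"

(* The supremum of the beth_l, read off inside the type: a set of cardinality beth_omega is a
   least upper bound, up to injections, of the sets of cardinality beth_l. Restricting the witnesses
   to subsets of the same type loses nothing, since every cardinal below that of a set is realised
   by one of its subsets. *)
definition is_beth_omega :: "'a set \<Rightarrow> bool" where
  "is_beth_omega S \<longleftrightarrow>
     (\<forall>l. \<exists>T :: 'a set. is_beth l T \<and> T \<lesssim> S) \<and>
     (\<forall>U :: 'a set. (\<forall>l. \<exists>T :: 'a set. is_beth l T \<and> T \<lesssim> U) \<longrightarrow> S \<lesssim> U)"

(* The sets A_i are the fibres of the level function, so they are pairwise disjoint by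
   construction. HOL alone proves no type to have beth_omega elements, so the class has no provable
   instance; it is a standing hypothesis on the type of atoms. *)
class atoms =
  fixes level :: "'a \<Rightarrow> int"
  assumes is_beth_omega_level: "is_beth_omega {a. level a = i}"

definition \<A> :: "int \<Rightarrow> 'a::atoms set" where
  "\<A> i = {a. level a = i}"

definition small :: "'a set \<Rightarrow> bool" where
  "small S \<longleftrightarrow> (\<exists>B :: 'a set. is_beth_omega B \<and> S \<prec> B)"

definition generous :: "'a set \<Rightarrow> bool" where
  "generous S \<longleftrightarrow> is_beth_omega S"

definition new_atom :: "int \<Rightarrow> ('a::atoms \<Rightarrow> bool) \<Rightarrow> bool" where
  "new_atom i \<Phi> \<longleftrightarrow> small (\<A> i - {a' \<in> \<A> i. \<Phi> a'})"

abbreviation swap :: "'a \<Rightarrow> 'a \<Rightarrow> 'a \<Rightarrow> 'a" where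
  "swap \<equiv> Transposition.transpose"

lemma infinite_level: "infinite {a::'a::atoms. level a = i}"
proof
  assume "finite {a::'a. level a = i}"
  moreover obtain T :: "'a set" where "is_beth 0 T" "T \<lesssim> {a::'a. level a = i}"
    using is_beth_omega_level[of i] unfolding is_beth_omega_def by blast
  ultimately have "finite T" "T \<approx> (UNIV::nat set)"
    by (auto simp: lepoll_def dest: inj_on_finite)
  then show False using eqpoll_finite_iff by blast
qed

lemma ex_fresh:
  assumes "finite F"
  obtains c :: "'a::atoms" where "level c = i" "c \<notin> F"
proof -
  have "\<not> {a::'a. level a = i} \<subseteq> F" using infinite_level assms finite_subset by blast
  then obtain c where "c \<in> {a::'a. level a = i}" "c \<notin> F" by blast
  then show ?thesis by (intro that[of c]) simp_all
qed

lemma small_finite: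
  assumes "finite (S :: 'a::atoms set)"
  shows "small S"
proof -
  have "S \<prec> {a::'a. level a = 0}"
    using finite_lesspoll_infinite[OF infinite_level assms] .
  then show ?thesis unfolding small_def using is_beth_omega_level by blast
qed

lemma is_beth_omega_eqpoll:
  fixes A B :: "'a set"
  assumes "is_beth_omega A" "is_beth_omega B"
  shows "A \<approx> B"
proof (rule lepoll_antisym)
  show "A \<lesssim> B" using assms unfolding is_beth_omega_def by simp
  show "B \<lesssim> A" using assms unfolding is_beth_omega_def by simp
qed

lemma infinite_is_beth_omega: "is_beth_omega A \<Longrightarrow> infinite A"
proof
  assume "finite A" "is_beth_omega A"
  moreover from this obtain T :: "'a set" where "is_beth 0 T" "T \<lesssim> A"
    unfolding is_beth_omega_def by blast
  ultimately have "finite T" "T \<approx> (UNIV::nat set)"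
    by (auto simp: lepoll_def dest: inj_on_finite)
  then show False using eqpoll_finite_iff by blast
qed

lemma small_Un_finite:
  fixes S F :: "'a set"
  assumes "small S" "finite F"
  shows "small (S \<union> F)"
proof -
  obtain B :: "'a set" where B: "is_beth_omega B" "S \<prec> B" using assms unfolding small_def by blast
  have "S \<union> F \<prec> B"
  proof (cases "finite S")
    case True
    then show ?thesis using assms B infinite_is_beth_omega finite_lesspoll_infinite by blast
  next
    case False
    have "S \<union> F \<approx> S"
      using assms(2) False
    proof (induction F rule: finite_induct)
      case (insert x F)
      have "insert x (S \<union> F) \<approx> S \<union> F"
        using insert.prems by (intro infinite_insert_eqpoll) simp
      then show ?case using insert by (simp add: eqpoll_trans)
    qed simp
    then show ?thesis using B by (meson eq_lesspoll_trans)
  qed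
  then show ?thesis using B unfolding small_def by blast
qed

lemma small_mono: "small S \<Longrightarrow> R \<subseteq> S \<Longrightarrow> small R"
  unfolding small_def by (meson subset_imp_lepoll lesspoll_trans1)


(* Raw syntax: levels are not enforced here but by internal_pred and internal_set below. *)
datatype 'a rpred =
    RAnd "'a rpred fset"
  | RNot "'a rpred"
  | RAll 'a "'a rpred"
  | RElt "'a rset" 'a
and 'a rset =
    RAtm 'a
  | RComp 'a "'a rpred"

(* Alpha-equivalence is the congruence generated by renaming a binder to an atom of the same level
   that does not occur at all; renaming to an atom that merely is not free follows by composing
   two such steps. *)
inductive
  aeq_p :: "'a::atoms rpred \<Rightarrow> 'a rpred \<Rightarrow> bool" and
  aeq_s :: "'a::atoms rset \<Rightarrow> 'a rset \<Rightarrow> bool"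
where
  aeq_p_refl: "aeq_p X X"
| aeq_p_sym: "aeq_p X Y \<Longrightarrow> aeq_p Y X"
| aeq_p_trans: "aeq_p X Y \<Longrightarrow> aeq_p Y Z \<Longrightarrow> aeq_p X Z"
| aeq_And: "rel_fset aeq_p \<X> \<Y> \<Longrightarrow> aeq_p (RAnd \<X>) (RAnd \<Y>)"
| aeq_Not: "aeq_p X Y \<Longrightarrow> aeq_p (RNot X) (RNot Y)"
| aeq_All: "aeq_p X Y \<Longrightarrow> aeq_p (RAll a X) (RAll a Y)"
| aeq_All_rename: "level b = level a \<Longrightarrow> b \<notin> set_rpred X
     \<Longrightarrow> aeq_p (RAll a X) (RAll b (map_rpred (swap b a) X))"
| aeq_Elt: "aeq_s x y \<Longrightarrow> aeq_p (RElt x a) (RElt y a)"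
| aeq_s_refl: "aeq_s x x"
| aeq_s_sym: "aeq_s x y \<Longrightarrow> aeq_s y x"
| aeq_s_trans: "aeq_s x y \<Longrightarrow> aeq_s y z \<Longrightarrow> aeq_s x z"
| aeq_Comp: "aeq_p X Y \<Longrightarrow> aeq_s (RComp a X) (RComp a Y)"
| aeq_Comp_rename: "level b = level a \<Longrightarrow> b \<notin> set_rpred X
     \<Longrightarrow> aeq_s (RComp a X) (RComp b (map_rpred (swap b a) X))"

definition level_perm :: "('a::atoms \<Rightarrow> 'a) \<Rightarrow> bool" where
  "level_perm \<pi> \<longleftrightarrow> bij \<pi> \<and> (\<forall>a b. level (\<pi> a) = level (\<pi> b) \<longleftrightarrow> level a = level b)"

lemma level_perm_swap: 
  assumes "level a = level b"
  shows "level_perm (swap a b)"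
proof -
  have "level (swap a b c) = level c" for c
    using assms by (cases "c = a"; cases "c = b") simp_all
  then show ?thesis by (simp add: level_perm_def)
qed

lemma level_perm_inj: "level_perm \<pi> \<Longrightarrow> inj \<pi>"
  by (simp add: level_perm_def bij_is_inj)

lemma swap_conj: "inj \<pi> \<Longrightarrow> \<pi> (swap a b c) = swap (\<pi> a) (\<pi> b) (\<pi> c)"
  by (auto simp: Transposition.transpose_def inj_eq)

lemma aeq_map:
  fixes X Y :: "'a::atoms rpred" and x y :: "'a rset"
  assumes "level_perm \<pi>"
  shows "aeq_p X Y \<Longrightarrow> aeq_p (map_rpred \<pi> X) (map_rpred \<pi> Y)"
    and "aeq_s x y \<Longrightarrow> aeq_s (map_rset \<pi> x) (map_rset \<pi> y)"
proof (induction rule: aeq_p_aeq_s.inducts)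
  case (aeq_And \<X> \<Y>)
  then show ?case
    by (auto simp: fset.rel_map intro!: aeq_p_aeq_s.aeq_And elim!: fset.rel_mono_strong)
next
  case (aeq_All_rename b a X)
  have "map_rpred \<pi> (map_rpred (swap b a) X) = map_rpred (swap (\<pi> b) (\<pi> a)) (map_rpred \<pi> X)"
    using assms by (auto simp: rpred.map_comp swap_conj level_perm_inj intro!: rpred.map_cong)
  then show ?case using aeq_All_rename assms
    by (auto intro!: aeq_p_aeq_s.aeq_All_rename simp: rpred.set_map level_perm_def inj_eq bij_is_inj)
next
  case (aeq_Comp_rename b a X)
  have "map_rpred \<pi> (map_rpred (swap b a) X) = map_rpred (swap (\<pi> b) (\<pi> a)) (map_rpred \<pi> X)"
    using assms by (auto simp: rpred.map_comp swap_conj level_perm_inj intro!: rpred.map_cong)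
  then show ?case using aeq_Comp_rename assms
    by (auto intro!: aeq_p_aeq_s.aeq_Comp_rename simp: rpred.set_map level_perm_def inj_eq bij_is_inj)
qed (auto intro: aeq_p_aeq_s.intros)

primrec rfa_p :: "'a rpred \<Rightarrow> 'a set" and rfa_s :: "'a rset \<Rightarrow> 'a set" where
  "rfa_p (RAnd \<X>) = \<Union> (fset (rfa_p |`| \<X>))"
| "rfa_p (RNot X) = rfa_p X"
| "rfa_p (RAll a X) = rfa_p X - {a}"
| "rfa_p (RElt x a) = insert a (rfa_s x)"
| "rfa_s (RAtm a) = {a}"
| "rfa_s (RComp a X) = rfa_p X - {a}"

lemma rfa_subset:
  fixes X :: "'a rpred" and x :: "'a rset"
  shows "rfa_p X \<subseteq> set_rpred X" "rfa_s x \<subseteq> set_rset x"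
  by (induction X and x) auto

lemma finite_set_raw:
  fixes X :: "'a rpred" and x :: "'a rset"
  shows "finite (set_rpred X)" "finite (set_rset x)"
  by (induction X and x) auto

lemma rfa_map:
  fixes X :: "'a rpred" and x :: "'a rset"
  assumes "inj \<pi>"
  shows "rfa_p (map_rpred \<pi> X) = \<pi> ` rfa_p X" "rfa_s (map_rset \<pi> x) = \<pi> ` rfa_s x"
  by (induction X and x) (use assms in \<open>auto simp: inj_eq image_iff\<close>)

lemma rfa_aeq:
  fixes X Y :: "'a::atoms rpred" and x y :: "'a rset"
  shows "aeq_p X Y \<Longrightarrow> rfa_p X = rfa_p Y"
    and "aeq_s x y \<Longrightarrow> rfa_s x = rfa_s y"
proof (induction rule: aeq_p_aeq_s.inducts)
  case (aeq_And \<X> \<Y>)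
  then show ?case by (fastforce simp: rel_fset_alt)
next
  case (aeq_All_rename b a X)
  then have "b \<notin> rfa_p X" using rfa_subset(1)[of X] by blast
  then show ?case by (auto simp: rfa_map in_transpose_image_iff Transposition.transpose_def)
next
  case (aeq_Comp_rename b a X)
  then have "b \<notin> rfa_p X" using rfa_subset(1)[of X] by blast
  then show ?case by (auto simp: rfa_map in_transpose_image_iff Transposition.transpose_def)
qed auto

definition aeq_bind :: "'a::atoms \<Rightarrow> 'a rpred \<Rightarrow> 'a \<Rightarrow> 'a rpred \<Rightarrow> bool" where
  "aeq_bind a X b Y \<longleftrightarrow> level a = level b \<and>
     (\<exists>F. finite F \<and> (\<forall>c. level c = level a \<and> c \<notin> F \<longrightarrow>
        aeq_p (map_rpred (swap c a) X) (map_rpred (swap c b) Y)))"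

fun shape_p :: "'a::atoms rpred \<Rightarrow> 'a rpred \<Rightarrow> bool" where
  "shape_p (RAnd \<X>) (RAnd \<Y>) \<longleftrightarrow> rel_fset aeq_p \<X> \<Y>"
| "shape_p (RNot X) (RNot Y) \<longleftrightarrow> aeq_p X Y"
| "shape_p (RAll a X) (RAll b Y) \<longleftrightarrow> aeq_bind a X b Y"
| "shape_p (RElt x a) (RElt y b) \<longleftrightarrow> aeq_s x y \<and> a = b"
| "shape_p _ _ \<longleftrightarrow> False"

fun shape_s :: "'a::atoms rset \<Rightarrow> 'a rset \<Rightarrow> bool" where
  "shape_s (RAtm a) (RAtm b) \<longleftrightarrow> a = b"
| "shape_s (RComp a X) (RComp b Y) \<longleftrightarrow> aeq_bind a X b Y"
| "shape_s _ _ \<longleftrightarrow> False"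

lemma rel_fset_aeq_sym: "rel_fset aeq_p \<X> \<Y> \<Longrightarrow> rel_fset aeq_p \<Y> \<X>"
  unfolding rel_fset_alt by (meson aeq_p_sym)

lemma rel_fset_aeq_trans: "rel_fset aeq_p \<X> \<Y> \<Longrightarrow> rel_fset aeq_p \<Y> \<Z> \<Longrightarrow> rel_fset aeq_p \<X> \<Z>"
  unfolding rel_fset_alt by (meson aeq_p_trans)

lemma aeq_bind_sym: "aeq_bind a X b Y \<Longrightarrow> aeq_bind b Y a X"
  unfolding aeq_bind_def by (metis aeq_p_sym)

lemma aeq_bind_trans:
  assumes "aeq_bind a X b Y" "aeq_bind b Y d Z"
  shows "aeq_bind a X d Z"
proof -
  obtain F G where "finite F" "finite G"
    and F: "\<And>c. level c = level a \<Longrightarrow> c \<notin> F \<Longrightarrow> aeq_p (map_rpred (swap c a) X) (map_rpred (swap c b) Y)"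
    and G: "\<And>c. level c = level b \<Longrightarrow> c \<notin> G \<Longrightarrow> aeq_p (map_rpred (swap c b) Y) (map_rpred (swap c d) Z)"
    using assms unfolding aeq_bind_def by blast
  moreover have "level a = level b" "level b = level d" using assms by (auto simp: aeq_bind_def)
  ultimately show ?thesis unfolding aeq_bind_def
    by (intro conjI exI[of _ "F \<union> G"] allI impI)
       (auto intro: aeq_p_trans[OF F G])
qed

lemma aeq_bind_cong: "aeq_p X Y \<Longrightarrow> aeq_bind a X a Y"
  unfolding aeq_bind_def
  by (intro conjI exI[of _ "{}"]) (auto intro: aeq_map level_perm_swap)

lemma swap_swap_fresh:
  assumes "b \<notin> set_rpred X" "c \<notin> set_rpred X"
  shows "map_rpred (swap c b) (map_rpred (swap b a) X) = map_rpred (swap c a) X"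
  using assms by (auto simp: rpred.map_comp Transposition.transpose_def intro!: rpred.map_cong)

lemma aeq_bind_rename:
  assumes "level b = level a" "b \<notin> set_rpred X"
  shows "aeq_bind a X b (map_rpred (swap b a) X)"
  using assms finite_set_raw(1)[of X] unfolding aeq_bind_def
  by (intro conjI exI[of _ "set_rpred X"]) (auto simp: swap_swap_fresh intro: aeq_p_refl)

lemma aeq_bind_imp:
  assumes "aeq_bind a X b Y"
  shows "aeq_p (RAll a X) (RAll b Y)" "aeq_s (RComp a X) (RComp b Y)"
proof -
  obtain F where "finite F" and *: "level a = level b"
    and F: "\<And>c. level c = level a \<Longrightarrow> c \<notin> F \<Longrightarrow> aeq_p (map_rpred (swap c a) X) (map_rpred (swap c b) Y)"
    using assms unfolding aeq_bind_def by blast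
  have "finite (F \<union> set_rpred X \<union> set_rpred Y)" using \<open>finite F\<close> finite_set_raw(1) by blast
  then obtain c where c: "level c = level a" "c \<notin> F \<union> set_rpred X \<union> set_rpred Y"
    by (rule ex_fresh)
  then have e: "aeq_p (map_rpred (swap c a) X) (map_rpred (swap c b) Y)" using F by blast
  show "aeq_p (RAll a X) (RAll b Y)"
    using c * aeq_p_trans[OF aeq_All_rename[of c a X] aeq_p_trans[OF aeq_All[OF e]
      aeq_p_sym[OF aeq_All_rename[of c b Y]]]] by simp
  show "aeq_s (RComp a X) (RComp b Y)"
    using c * aeq_s_trans[OF aeq_Comp_rename[of c a X] aeq_s_trans[OF aeq_Comp[OF e]
      aeq_s_sym[OF aeq_Comp_rename[of c b Y]]]] by simp
qed

lemma shape_p_sym: "shape_p R S \<Longrightarrow> shape_p S R"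
  by (cases R; cases S) (auto intro: aeq_p_sym aeq_s_sym rel_fset_aeq_sym aeq_bind_sym)

lemma shape_s_sym: "shape_s R S \<Longrightarrow> shape_s S R"
  by (cases R; cases S) (auto intro: aeq_bind_sym)

lemma shape_p_trans: "shape_p R S \<Longrightarrow> shape_p S T \<Longrightarrow> shape_p R T"
  by (cases R; cases S; simp; cases T; simp)
     (blast intro: aeq_p_trans aeq_s_trans rel_fset_aeq_trans aeq_bind_trans)+

lemma shape_s_trans: "shape_s R S \<Longrightarrow> shape_s S T \<Longrightarrow> shape_s R T"
  by (cases R; cases S; simp; cases T; simp) (blast intro: aeq_bind_trans)+

lemma aeq_shape:
  fixes X Y :: "'a::atoms rpred" and x y :: "'a rset"
  shows "aeq_p X Y \<Longrightarrow> shape_p X Y"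
    and "aeq_s x y \<Longrightarrow> shape_s x y"
proof (induction rule: aeq_p_aeq_s.inducts)
  case (aeq_p_refl X)
  show ?case by (cases X) (auto simp: fset.rel_refl aeq_p_aeq_s.aeq_p_refl aeq_s_refl intro: aeq_bind_cong)
next
  case (aeq_s_refl X)
  show ?case by (cases X) (auto simp: aeq_p_refl intro: aeq_bind_cong)
next
  case (aeq_And \<X> \<Y>)
  then show ?case by (auto elim!: fset.rel_mono_strong)
qed (auto intro: shape_p_trans shape_p_sym shape_s_trans shape_s_sym aeq_bind_cong aeq_bind_rename)

quotient_type (overloaded) 'a ipred = "'a::atoms rpred" / aeq_p
  by (intro equivpI reflpI sympI transpI) (blast intro: aeq_p_refl aeq_p_sym aeq_p_trans)+

quotient_type (overloaded) 'a iset = "'a::atoms rset" / aeq_s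
  by (intro equivpI reflpI sympI transpI) (blast intro: aeq_s_refl aeq_s_sym aeq_s_trans)+

lift_definition IAnd :: "'a::atoms ipred fset \<Rightarrow> 'a ipred" is RAnd
  by (rule aeq_And)
lift_definition INot :: "'a::atoms ipred \<Rightarrow> 'a ipred" is RNot
  by (rule aeq_Not)
lift_definition IAll :: "'a::atoms \<Rightarrow> 'a ipred \<Rightarrow> 'a ipred" is RAll
  by (rule aeq_All)
lift_definition IElt :: "'a::atoms iset \<Rightarrow> 'a \<Rightarrow> 'a ipred" is RElt
  by (rule aeq_Elt)
lift_definition IAtm :: "'a::atoms \<Rightarrow> 'a iset" is RAtm .
lift_definition IComp :: "'a::atoms \<Rightarrow> 'a ipred \<Rightarrow> 'a iset" is RComp
  by (rule aeq_Comp)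

lift_definition fa_p :: "'a::atoms ipred \<Rightarrow> 'a set" is rfa_p
  by (rule rfa_aeq)
lift_definition fa_s :: "'a::atoms iset \<Rightarrow> 'a set" is rfa_s
  by (rule rfa_aeq)

(* Renaming of all atoms. The choice of representative is irrelevant, by rename_abs, whenever
   level_perm holds, which covers swappings of atoms of equal level and shift permutations. *)
definition rename_p :: "('a \<Rightarrow> 'a) \<Rightarrow> 'a::atoms ipred \<Rightarrow> 'a ipred" where
  "rename_p \<pi> X = abs_ipred (map_rpred \<pi> (rep_ipred X))"
definition rename_s :: "('a \<Rightarrow> 'a) \<Rightarrow> 'a::atoms iset \<Rightarrow> 'a iset" where
  "rename_s \<pi> x = abs_iset (map_rset \<pi> (rep_iset x))"

lemma aeq_rep_abs: "aeq_p (rep_ipred (abs_ipred R)) R" "aeq_s (rep_iset (abs_iset r)) r"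
  by (metis Quotient3_ipred Quotient3_rel_abs aeq_p_refl aeq_p_sym rep_abs_rsp_left)
     (metis Quotient3_iset Quotient3_rel_abs aeq_s_refl aeq_s_sym rep_abs_rsp_left)

lemma ipred_ex_abs: "\<exists>R. X = abs_ipred R"
  by (rule exI[of _ "rep_ipred X"]) (simp add: Quotient3_abs_rep[OF Quotient3_ipred])

lemma iset_ex_abs: "\<exists>r. x = abs_iset r"
  by (rule exI[of _ "rep_iset x"]) (simp add: Quotient3_abs_rep[OF Quotient3_iset])

lemma rename_abs:
  assumes "level_perm \<pi>"
  shows "rename_p \<pi> (abs_ipred R) = abs_ipred (map_rpred \<pi> R)"
    and "rename_s \<pi> (abs_iset r) = abs_iset (map_rset \<pi> r)"
  using aeq_map(1)[OF assms aeq_rep_abs(1)] aeq_map(2)[OF assms aeq_rep_abs(2)]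
  by (simp_all add: rename_p_def rename_s_def ipred.abs_eq_iff iset.abs_eq_iff)

lemma IAnd_abs: "IAnd (abs_ipred |`| \<X>) = abs_ipred (RAnd \<X>)"
  by (auto simp: IAnd_def ipred.abs_eq_iff fset.map_comp comp_def fset.rel_map fset.rel_refl aeq_rep_abs intro!: aeq_And)
  
lemma ipred_fset_abs: "\<exists>\<R>. \<X> = abs_ipred |`| \<R>"
  by (rule exI[of _ "rep_ipred |`| \<X>"]) (auto simp: fset.map_comp Quotient3_abs_rep[OF Quotient3_ipred] comp_def)

lemma rename_simps:
  fixes X :: "'a::atoms ipred" and x :: "'a iset"
  assumes "level_perm \<pi>"
  shows "rename_p \<pi> (IAnd \<X>) = IAnd (rename_p \<pi> |`| \<X>)"
    and "rename_p \<pi> (INot X) = INot (rename_p \<pi> X)"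
    and "rename_p \<pi> (IAll a X) = IAll (\<pi> a) (rename_p \<pi> X)"
    and "rename_p \<pi> (IElt x a) = IElt (rename_s \<pi> x) (\<pi> a)"
    and "rename_s \<pi> (IAtm a) = IAtm (\<pi> a)"
    and "rename_s \<pi> (IComp a X) = IComp (\<pi> a) (rename_p \<pi> X)"
proof -
  obtain \<R> where \<R>: "\<X> = abs_ipred |`| \<R>" using ipred_fset_abs by blast
  have 1: "(\<lambda>x. rename_p \<pi> (abs_ipred x)) |`| \<R> = (abs_ipred \<circ> map_rpred \<pi>) |`| \<R>"
    by (simp add: rename_abs assms comp_def)
  obtain R r where R: "X = abs_ipred R" "x = abs_iset r"
    using ipred_ex_abs iset_ex_abs by blast
  show "rename_p \<pi> (INot X) = INot (rename_p \<pi> X)"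
    and "rename_p \<pi> (IAll a X) = IAll (\<pi> a) (rename_p \<pi> X)"
    and "rename_p \<pi> (IElt x a) = IElt (rename_s \<pi> x) (\<pi> a)"
    and "rename_s \<pi> (IAtm a) = IAtm (\<pi> a)"
    and "rename_s \<pi> (IComp a X) = IComp (\<pi> a) (rename_p \<pi> X)"
    using assms by (simp_all add: R rename_abs INot.abs_eq IAll.abs_eq IElt.abs_eq IAtm.abs_eq IComp.abs_eq)
  show "rename_p \<pi> (IAnd \<X>) = IAnd (rename_p \<pi> |`| \<X>)"
    using assms unfolding \<R> using IAnd_abs[of "map_rpred \<pi> |`| \<R>"]
    by (simp add: IAnd_abs rename_abs fset.map_comp comp_def)
qed


(* Prepoints are sets of pairs (a, y), standing for "a triangleright y", and contain
   alpha-equivalence classes, whence abs_iset; sat_IAnd, sat_INot, sat_IAll and sat_IElt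
   restate the clauses for the quotient. *)
function rsat :: "('a::atoms \<times> 'a iset) set \<Rightarrow> 'a rpred \<Rightarrow> bool" where
  "rsat p (RAnd \<X>) \<longleftrightarrow> (\<forall>X \<in> fset \<X>. rsat p X)"
| "rsat p (RNot X) \<longleftrightarrow> \<not> rsat p X"
| "rsat p (RAll a X) \<longleftrightarrow> new_atom (level a) (\<lambda>a'. rsat p (map_rpred (swap a' a) X))"
| "rsat p (RElt y a) \<longleftrightarrow> (a, abs_iset y) \<in> p"
  by pat_completeness auto
lemma size_map_raw:
  fixes X :: "'a rpred" and x :: "'a rset"
  shows "size (map_rpred f X) \<le> size X" "size (map_rset f x) \<le> size x"
proof (induction X and x)
  case (RAnd \<X>)
  have "(\<Sum>x\<in>fset (map_rpred f |`| \<X>). Suc (size x)) \<le> (\<Sum>x\<in>fset \<X>. Suc (size (map_rpred f x)))"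
    using sum_image_le[of "fset \<X>" "\<lambda>x. Suc (size x)" "map_rpred f"] by (simp add: comp_def)
  also have "\<dots> \<le> (\<Sum>x\<in>fset \<X>. Suc (size x))"
    using RAnd by (intro sum_mono) simp
  finally show ?case by simp
qed auto
termination
proof (relation "measure (size \<circ> snd)")
  fix p \<X> and X :: "'a rpred" assume "X \<in> fset \<X>"
  then have "Suc (size X) \<le> (\<Sum>x\<in>fset \<X>. Suc (size x))"
    by (meson finite_fset member_le_sum zero_le)
  then show "((p, X), p, RAnd \<X>) \<in> measure (size \<circ> snd)" by simp
qed (auto simp: size_map_raw le_imp_less_Suc)


lemma new_atom_cofinite_cong:
  fixes F :: "'a::atoms set"
  assumes "finite F" "\<And>c. level c = i \<Longrightarrow> c \<notin> F \<Longrightarrow> \<Phi> c \<longleftrightarrow> \<Psi> c"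
  shows "new_atom i \<Phi> \<longleftrightarrow> new_atom i \<Psi>"
proof -
  have "new_atom i \<Psi>" if \<Phi>: "new_atom i \<Phi>"
    and eq: "\<And>c. level c = i \<Longrightarrow> c \<notin> F \<Longrightarrow> \<Phi> c \<longleftrightarrow> \<Psi> c" for \<Phi> \<Psi>
    unfolding new_atom_def
  proof (rule small_mono)
    show "small ((\<A> i - {a' \<in> \<A> i. \<Phi> a'}) \<union> F)"
      using small_Un_finite \<Phi> assms(1) unfolding new_atom_def by blast
    show "\<A> i - {a' \<in> \<A> i. \<Psi> a'} \<subseteq> (\<A> i - {a' \<in> \<A> i. \<Phi> a'}) \<union> F"
      using eq unfolding \<A>_def by blast
  qed
  then show ?thesis using assms(2) by blast
qed

lemma level_perm_comp: "level_perm \<pi> \<Longrightarrow> level_perm \<rho> \<Longrightarrow> level_perm (\<pi> \<circ> \<rho>)"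
  by (auto simp: level_perm_def bij_comp)

lemma rsat_aeq_perm:
  fixes X Y :: "'a::atoms rpred" and x y :: "'a rset"
  shows "aeq_p X Y \<Longrightarrow> \<forall>\<pi>. level_perm \<pi> \<longrightarrow> (rsat p (map_rpred \<pi> X) \<longleftrightarrow> rsat p (map_rpred \<pi> Y))"
    and "aeq_s x y \<Longrightarrow> True"
proof (induction rule: aeq_p_aeq_s.inducts)
  case (aeq_And \<X> \<Y>)
  then show ?case by (fastforce simp: rel_fset_alt)
next
  case (aeq_All X Y a)
  show ?case
  proof (intro allI impI)
    fix \<pi> :: "'a \<Rightarrow> 'a" assume \<pi>: "level_perm \<pi>"
    have "new_atom (level (\<pi> a)) (\<lambda>c. rsat p (map_rpred (swap c (\<pi> a) \<circ> \<pi>) X)) \<longleftrightarrow>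
      new_atom (level (\<pi> a)) (\<lambda>c. rsat p (map_rpred (swap c (\<pi> a) \<circ> \<pi>) Y))"
    proof (rule new_atom_cofinite_cong[OF finite.emptyI])
      fix c :: 'a assume "level c = level (\<pi> a)"
      then have "level_perm (swap c (\<pi> a) \<circ> \<pi>)" by (intro level_perm_comp level_perm_swap \<pi>)
      then show "rsat p (map_rpred (swap c (\<pi> a) \<circ> \<pi>) X) \<longleftrightarrow> rsat p (map_rpred (swap c (\<pi> a) \<circ> \<pi>) Y)"
        using aeq_All.IH by blast
    qed
    then show "rsat p (map_rpred \<pi> (RAll a X)) \<longleftrightarrow> rsat p (map_rpred \<pi> (RAll a Y))"
      by (simp add: rpred.map_comp)
  qed
next
  case (aeq_All_rename b a X)
  show ?case
  proof (intro allI impI)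
    fix \<pi> :: "'a \<Rightarrow> 'a" assume \<pi>: "level_perm \<pi>"
    have "map_rpred (swap c (\<pi> a) \<circ> \<pi>) X = map_rpred (swap c (\<pi> b) \<circ> (\<pi> \<circ> swap b a)) X"
      if "c \<notin> \<pi> ` set_rpred X" for c
      using that aeq_All_rename level_perm_inj[OF \<pi>]
      by (intro rpred.map_cong refl) (auto simp: Transposition.transpose_def inj_eq)
    then have "new_atom (level (\<pi> a)) (\<lambda>c. rsat p (map_rpred (swap c (\<pi> a) \<circ> \<pi>) X)) \<longleftrightarrow>
      new_atom (level (\<pi> a)) (\<lambda>c. rsat p (map_rpred (swap c (\<pi> b) \<circ> (\<pi> \<circ> swap b a)) X))"
      using finite_set_raw(1)[of X]
      by (intro new_atom_cofinite_cong[of "\<pi> ` set_rpred X"]) auto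
    moreover have "level (\<pi> b) = level (\<pi> a)" using \<pi> aeq_All_rename by (simp add: level_perm_def)
    ultimately show "rsat p (map_rpred \<pi> (RAll a X)) \<longleftrightarrow>
        rsat p (map_rpred \<pi> (RAll b (map_rpred (swap b a) X)))"
      by (simp add: rpred.map_comp)
  qed
next
  case (aeq_Elt x y a)
  show ?case
  proof (intro allI impI)
    fix \<pi> :: "'a \<Rightarrow> 'a" assume \<pi>: "level_perm \<pi>"
    have "abs_iset (map_rset \<pi> x) = abs_iset (map_rset \<pi> y)"
      using aeq_map(2)[OF \<pi> aeq_Elt.hyps] by (simp add: iset.abs_eq_iff)
    then show "rsat p (map_rpred \<pi> (RElt x a)) \<longleftrightarrow> rsat p (map_rpred \<pi> (RElt y a))" by simp
  qed
qed auto

lemma rsat_aeq: "aeq_p X Y \<Longrightarrow> rsat p X \<longleftrightarrow> rsat p Y"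
  using rsat_aeq_perm(1)[of X Y p] level_perm_swap[of undefined undefined]
  by (auto simp: rpred.map_id0 simp flip: id_def)

lift_definition sat :: "('a::atoms \<times> 'a iset) set \<Rightarrow> 'a ipred \<Rightarrow> bool"  (infix "\<Turnstile>" 50)
  is rsat by (rule rsat_aeq)

lemma sat_IAnd: "p \<Turnstile> IAnd \<X> \<longleftrightarrow> (\<forall>X \<in> fset \<X>. p \<Turnstile> X)"
  using ipred_fset_abs[of \<X>] by (auto simp: IAnd_abs sat.abs_eq)
lemma sat_INot: "p \<Turnstile> INot X \<longleftrightarrow> \<not> p \<Turnstile> X"
  by transfer simp
lemma sat_IAll: "p \<Turnstile> IAll a X \<longleftrightarrow> new_atom (level a) (\<lambda>a'. p \<Turnstile> rename_p (swap a' a) X)"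
proof -
  obtain R where R: "X = abs_ipred R" using ipred_ex_abs by blast
  show ?thesis unfolding R IAll.abs_eq sat.abs_eq rsat.simps
    by (rule new_atom_cofinite_cong[OF finite.emptyI])
       (simp add: rename_abs level_perm_swap sat.abs_eq)
qed
lemma sat_IElt: "p \<Turnstile> IElt y a \<longleftrightarrow> (a, y) \<in> p"
  using iset_ex_abs[of y] by (auto simp: IElt.abs_eq sat.abs_eq)

lemma fa_simps [simp]:
  "fa_p (IAnd \<X>) = (\<Union>X \<in> fset \<X>. fa_p X)"
  "fa_p (INot X) = fa_p X"
  "fa_p (IAll a X) = fa_p X - {a}"
  "fa_p (IElt x a) = insert a (fa_s x)"
  "fa_s (IAtm a) = {a}"
  "fa_s (IComp a X) = fa_p X - {a}"
proof -
  show "fa_p (IAnd \<X>) = (\<Union>X \<in> fset \<X>. fa_p X)"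
    using ipred_fset_abs[of \<X>] by (auto simp: IAnd_abs fa_p.abs_eq)
qed (transfer; simp)+

lemma finite_fa [simp]: "finite (fa_p X)" "finite (fa_s x)"
  by (transfer, rule finite_subset[OF rfa_subset(1) finite_set_raw(1)],
      transfer, rule finite_subset[OF rfa_subset(2) finite_set_raw(2)])

lemma fa_rename:
  assumes "level_perm \<pi>"
  shows "fa_p (rename_p \<pi> X) = \<pi> ` fa_p X" "fa_s (rename_s \<pi> x) = \<pi> ` fa_s x"
  using ipred_ex_abs[of X] iset_ex_abs[of x] assms
  by (auto simp: rename_abs fa_p.abs_eq fa_s.abs_eq rfa_map level_perm_inj)

definition level_preserving :: "('a::atoms \<Rightarrow> 'a) \<Rightarrow> bool" where
  "level_preserving \<pi> \<longleftrightarrow> bij \<pi> \<and> (\<forall>a. level (\<pi> a) = level a)"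

lemma level_preserving_level_perm: "level_preserving \<pi> \<Longrightarrow> level_perm \<pi>"
  by (simp add: level_preserving_def level_perm_def)

lemma level_preserving_id: "level_preserving id" "level_preserving (\<lambda>x. x)"
  by (auto simp: level_preserving_def simp flip: id_def)

lemma level_preserving_comp: "level_preserving \<pi> \<Longrightarrow> level_preserving \<rho> \<Longrightarrow> level_preserving (\<pi> \<circ> \<rho>)"
  by (simp add: level_preserving_def bij_comp)

lemma level_preserving_swap: 
  assumes "level a = level b"
  shows "level_preserving (swap a b)"
proof -
  have "level (swap a b c) = level c" for c
    using assms by (cases "c = a"; cases "c = b") simp_all
  then show ?thesis by (simp add: level_preserving_def)
qed

lemma rename_comp:
  assumes "level_perm \<pi>" "level_perm \<rho>"
  shows "rename_p \<pi> (rename_p \<rho> X) = rename_p (\<pi> \<circ> \<rho>) X"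
    and "rename_s \<pi> (rename_s \<rho> x) = rename_s (\<pi> \<circ> \<rho>) x"
  using ipred_ex_abs[of X] iset_ex_abs[of x] assms
  by (auto simp: rename_abs level_perm_comp rpred.map_comp rset.map_comp)

lemma raw_map_agree:
  fixes R :: "'a::atoms rpred" and r :: "'a rset"
  shows "\<And>\<pi> \<rho>. level_preserving \<pi> \<Longrightarrow> level_preserving \<rho> \<Longrightarrow> (\<And>a. a \<in> rfa_p R \<Longrightarrow> \<pi> a = \<rho> a)
           \<Longrightarrow> aeq_p (map_rpred \<pi> R) (map_rpred \<rho> R)"
    and "\<And>\<pi> \<rho>. level_preserving \<pi> \<Longrightarrow> level_preserving \<rho> \<Longrightarrow> (\<And>a. a \<in> rfa_s r \<Longrightarrow> \<pi> a = \<rho> a)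
           \<Longrightarrow> aeq_s (map_rset \<pi> r) (map_rset \<rho> r)"
proof (induction R and r)
  case (RAnd \<X>)
  then show ?case
    unfolding rpred.map by (intro aeq_And) (force simp: fset.rel_map intro!: fset.rel_refl_strong RAnd.IH)
next
  case (RAll a X)
  have "aeq_bind (\<pi> a) (map_rpred \<pi> X) (\<rho> a) (map_rpred \<rho> X)"
    unfolding aeq_bind_def
  proof (intro conjI exI[of _ "\<pi> ` set_rpred X"] allI impI)
    fix c :: 'a assume c: "level c = level (\<pi> a) \<and> c \<notin> \<pi> ` set_rpred X"
    have "aeq_p (map_rpred (swap c (\<pi> a) \<circ> \<pi>) X) (map_rpred (swap c (\<rho> a) \<circ> \<rho>) X)"
    proof (rule RAll.IH)
      fix z assume z: "z \<in> rfa_p X"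
      then have "c \<noteq> \<pi> z" using c rfa_subset(1)[of X] by blast
      moreover have "inj \<pi>" "inj \<rho>" using RAll.prems by (auto simp: level_preserving_def bij_is_inj)
      ultimately show "(swap c (\<pi> a) \<circ> \<pi>) z = (swap c (\<rho> a) \<circ> \<rho>) z"
        using RAll.prems(3)[of z] z by (cases "z = a") (auto simp: Transposition.transpose_def inj_eq)
    next
      show "level_preserving (swap c (\<pi> a) \<circ> \<pi>)"
        by (rule level_preserving_comp[OF level_preserving_swap]) (use c RAll.prems(1) in simp_all)
      have "level c = level (\<rho> a)" using c RAll.prems(1,2) by (simp add: level_preserving_def)
      then show "level_preserving (swap c (\<rho> a) \<circ> \<rho>)"
        by (rule level_preserving_comp[OF level_preserving_swap RAll.prems(2)])
    qed
    then show "aeq_p (map_rpred (swap c (\<pi> a)) (map_rpred \<pi> X)) (map_rpred (swap c (\<rho> a)) (map_rpred \<rho> X))"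
      by (simp add: rpred.map_comp)
  qed (use RAll.prems in \<open>auto simp: level_preserving_def finite_set_raw\<close>)
  then show ?case by (simp add: aeq_bind_imp)
next
  case (RComp a X)
  have "aeq_bind (\<pi> a) (map_rpred \<pi> X) (\<rho> a) (map_rpred \<rho> X)"
    unfolding aeq_bind_def
  proof (intro conjI exI[of _ "\<pi> ` set_rpred X"] allI impI)
    fix c :: 'a assume c: "level c = level (\<pi> a) \<and> c \<notin> \<pi> ` set_rpred X"
    have "aeq_p (map_rpred (swap c (\<pi> a) \<circ> \<pi>) X) (map_rpred (swap c (\<rho> a) \<circ> \<rho>) X)"
    proof (rule RComp.IH)
      fix z assume z: "z \<in> rfa_p X"
      then have "c \<noteq> \<pi> z" using c rfa_subset(1)[of X] by blast
      moreover have "inj \<pi>" "inj \<rho>" using RComp.prems by (auto simp: level_preserving_def bij_is_inj)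
      ultimately show "(swap c (\<pi> a) \<circ> \<pi>) z = (swap c (\<rho> a) \<circ> \<rho>) z"
        using RComp.prems(3)[of z] z by (cases "z = a") (auto simp: Transposition.transpose_def inj_eq)
    next
      show "level_preserving (swap c (\<pi> a) \<circ> \<pi>)"
        by (rule level_preserving_comp[OF level_preserving_swap]) (use c RComp.prems(1) in simp_all)
      have "level c = level (\<rho> a)" using c RComp.prems(1,2) by (simp add: level_preserving_def)
      then show "level_preserving (swap c (\<rho> a) \<circ> \<rho>)"
        by (rule level_preserving_comp[OF level_preserving_swap RComp.prems(2)])
    qed
    then show "aeq_p (map_rpred (swap c (\<pi> a)) (map_rpred \<pi> X)) (map_rpred (swap c (\<rho> a)) (map_rpred \<rho> X))"
      by (simp add: rpred.map_comp)
  qed (use RComp.prems in \<open>auto simp: level_preserving_def finite_set_raw\<close>)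
  then show ?case by (simp add: aeq_bind_imp)
qed (auto intro: aeq_Not aeq_Elt aeq_s_refl)

lemma rename_agree:
  assumes "level_preserving \<pi>" "level_preserving \<rho>"
  shows "(\<And>a. a \<in> fa_p X \<Longrightarrow> \<pi> a = \<rho> a) \<Longrightarrow> rename_p \<pi> X = rename_p \<rho> X"
    and "(\<And>a. a \<in> fa_s x \<Longrightarrow> \<pi> a = \<rho> a) \<Longrightarrow> rename_s \<pi> x = rename_s \<rho> x"
proof -
  show "rename_p \<pi> X = rename_p \<rho> X" if *: "\<And>a. a \<in> fa_p X \<Longrightarrow> \<pi> a = \<rho> a"
  proof -
    obtain R where 1: "X = abs_ipred R" using ipred_ex_abs by blast
    have "aeq_p (map_rpred \<pi> R) (map_rpred \<rho> R)"
      by (rule raw_map_agree(1)[OF assms]) (use * 1 in \<open>simp add: fa_p.abs_eq\<close>)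
    then show ?thesis using assms 1 by (simp add: rename_abs level_preserving_level_perm ipred.abs_eq_iff)
  qed
  show "rename_s \<pi> x = rename_s \<rho> x" if *: "\<And>a. a \<in> fa_s x \<Longrightarrow> \<pi> a = \<rho> a"
  proof -
    obtain R where 1: "x = abs_iset R" using iset_ex_abs by blast
    have "aeq_s (map_rset \<pi> R) (map_rset \<rho> R)"
      by (rule raw_map_agree(2)[OF assms]) (use * 1 in \<open>simp add: fa_s.abs_eq\<close>)
    then show ?thesis using assms 1 by (simp add: rename_abs level_preserving_level_perm iset.abs_eq_iff)
  qed
qed

lemma rename_id [simp]: "rename_p id X = X" "rename_s id x = x"
  using ipred_ex_abs[of X] iset_ex_abs[of x]
  by (auto simp: rename_abs level_preserving_level_perm level_preserving_id rpred.map_id0 rset.map_id0)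

lemma rename_fresh:
  assumes "level a = level b" "a \<notin> fa_p X" "b \<notin> fa_p X"
  shows "rename_p (swap a b) X = X"
proof -
  have "rename_p (swap a b) X = rename_p id X"
  proof (rule rename_agree(1)[OF level_preserving_swap[OF assms(1)] level_preserving_id(1)])
    fix c assume "c \<in> fa_p X"
    then have "c \<noteq> a" "c \<noteq> b" using assms by auto
    then show "swap a b c = id c" by simp
  qed
  then show ?thesis by simp
qed

lemma rename_s_fresh:
  assumes "level a = level b" "a \<notin> fa_s x" "b \<notin> fa_s x"
  shows "rename_s (swap a b) x = x"
proof -
  have "rename_s (swap a b) x = rename_s id x"
  proof (rule rename_agree(2)[OF level_preserving_swap[OF assms(1)] level_preserving_id(1)])
    fix c assume "c \<in> fa_s x"
    then have "c \<noteq> a" "c \<noteq> b" using assms by auto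
    then show "swap a b c = id c" by simp
  qed
  then show ?thesis by simp
qed

definition bind_eq :: "'a::atoms \<Rightarrow> 'a ipred \<Rightarrow> 'a \<Rightarrow> 'a ipred \<Rightarrow> bool" where
  "bind_eq a X b Y \<longleftrightarrow> level a = level b \<and> b \<notin> fa_p X - {a} \<and> Y = rename_p (swap b a) X"

lemma rename_swap_swap:
  assumes "level c = level a" "level b = level a" "b \<notin> fa_p X - {a}" "c \<notin> fa_p X"
  shows "rename_p (swap c b) (rename_p (swap b a) X) = rename_p (swap c a) X"
proof -
  have "rename_p (swap c b \<circ> swap b a) X = rename_p (swap c a) X"
    using assms by (intro rename_agree level_preserving_comp level_preserving_swap) (auto simp: Transposition.transpose_def)
  then show ?thesis using assms by (simp add: rename_comp level_perm_swap)
qed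

lemma aeq_bind_iff: "aeq_bind a R b S \<longleftrightarrow> bind_eq a (abs_ipred R) b (abs_ipred S)"
proof
  assume *: "aeq_bind a R b S"
  then obtain F where "finite F" and ab: "level a = level b"
    and F: "\<And>c. level c = level a \<Longrightarrow> c \<notin> F \<Longrightarrow> aeq_p (map_rpred (swap c a) R) (map_rpred (swap c b) S)"
    unfolding aeq_bind_def by blast
  let ?X = "abs_ipred R" and ?Y = "abs_ipred S"
  have "finite (F \<union> fa_p ?X \<union> fa_p ?Y \<union> {a, b})" using \<open>finite F\<close> by simp
  then obtain c where c: "level c = level a" "c \<notin> F \<union> fa_p ?X \<union> fa_p ?Y \<union> {a, b}"
    by (rule ex_fresh)
  have eq: "rename_p (swap c a) ?X = rename_p (swap c b) ?Y"
    using F[of c] c ab by (simp add: rename_abs level_perm_swap ipred.abs_eq_iff)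
  then have "swap c a ` fa_p ?X = swap c b ` fa_p ?Y"
    using c ab fa_rename(1)[OF level_perm_swap] by metis
  moreover have "b \<notin> swap c b ` fa_p ?Y" using c
    by (auto simp: Transposition.transpose_def split: if_splits)
  ultimately have "b \<notin> swap c a ` fa_p ?X" by simp
  then have b: "b \<notin> fa_p ?X - {a}"
    using c by (auto simp: Transposition.transpose_def image_iff split: if_splits)
  have "?Y = rename_p (swap c b) (rename_p (swap c b) ?Y)"
    using c ab by (simp add: rename_comp level_perm_swap)
  also have "\<dots> = rename_p (swap c b) (rename_p (swap c a) ?X)" using eq by simp
  also have "\<dots> = rename_p (swap b a) ?X"
  proof -
    have "rename_p (swap c b \<circ> swap c a) ?X = rename_p (swap b a) ?X"
    proof (rule rename_agree(1))
      show "level_preserving (swap c b \<circ> swap c a)" "level_preserving (swap b a)"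
        using c ab by (simp_all add: level_preserving_comp level_preserving_swap)
      show "(swap c b \<circ> swap c a) z = swap b a z" if "z \<in> fa_p ?X" for z
        using that b c by (auto simp: Transposition.transpose_def)
    qed
    then show ?thesis using c ab by (simp add: rename_comp level_perm_swap)
  qed
  finally show "bind_eq a ?X b ?Y" using b ab by (simp add: bind_eq_def)
next
  assume "bind_eq a (abs_ipred R) b (abs_ipred S)"
  then have l: "level b = level a" and b: "b \<notin> fa_p (abs_ipred R) - {a}"
    and S: "abs_ipred S = rename_p (swap b a) (abs_ipred R)" by (simp_all add: bind_eq_def)
  show "aeq_bind a R b S" unfolding aeq_bind_def
  proof (intro conjI exI[of _ "fa_p (abs_ipred R)"] allI impI)
    fix c :: 'a assume c: "level c = level a \<and> c \<notin> fa_p (abs_ipred R)"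
    have "rename_p (swap c a) (abs_ipred R) = rename_p (swap c b) (abs_ipred S)"
      unfolding S using rename_swap_swap[of c a b "abs_ipred R"] c l b by metis
    moreover have "level_perm (swap c a)" "level_perm (swap c b)"
      using c l level_perm_swap by metis+
    ultimately show "aeq_p (map_rpred (swap c a) R) (map_rpred (swap c b) S)"
      by (simp only: rename_abs ipred.abs_eq_iff)
  qed (simp_all add: l)
qed

lemma binder_eq_iff:
  "IAll a X = IAll b Y \<longleftrightarrow> bind_eq a X b Y"
  "IComp a X = IComp b Y \<longleftrightarrow> bind_eq a X b Y"
proof -
  obtain R S where RS: "X = abs_ipred R" "Y = abs_ipred S" using ipred_ex_abs by metis
  show "IAll a X = IAll b Y \<longleftrightarrow> bind_eq a X b Y"
    unfolding RS IAll.abs_eq ipred.abs_eq_iff aeq_bind_iff[symmetric]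
    using aeq_bind_imp(1)[of a R b S] aeq_shape(1)[of "RAll a R" "RAll b S"] by auto
  show "IComp a X = IComp b Y \<longleftrightarrow> bind_eq a X b Y"
    unfolding RS IComp.abs_eq iset.abs_eq_iff aeq_bind_iff[symmetric]
    using aeq_bind_imp(2)[of a R b S] aeq_shape(2)[of "RComp a R" "RComp b S"] by auto
qed

lemma ipred_inject [simp]:
  "INot X = INot Y \<longleftrightarrow> X = Y"
  "IElt x a = IElt y b \<longleftrightarrow> x = y \<and> a = b"
  "IAtm a = IAtm b \<longleftrightarrow> a = b"
  by (transfer; auto intro: aeq_p_aeq_s.intros dest: aeq_shape)+

lemma IAnd_inject [simp]: "IAnd \<X> = IAnd \<Y> \<longleftrightarrow> \<X> = \<Y>"
proof
  assume "IAnd \<X> = IAnd \<Y>"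
  then have "aeq_p (RAnd (rep_ipred |`| \<X>)) (RAnd (rep_ipred |`| \<Y>))"
    by (simp add: IAnd_def ipred.abs_eq_iff)
  then have "rel_fset (\<lambda>X Y. aeq_p (rep_ipred X) (rep_ipred Y)) \<X> \<Y>"
    by (auto simp: fset.rel_map dest: aeq_shape)
  then have "rel_fset (=) \<X> \<Y>"
    by (rule fset.rel_mono_strong) (metis Quotient3_ipred Quotient3_rel_rep)
  then show "\<X> = \<Y>" by (simp add: fset.rel_eq)
qed simp

lemma ipred_distinct [simp]:
  "IAnd \<X> \<noteq> INot X" "INot X \<noteq> IAnd \<X>"
  "IAnd \<X> \<noteq> IAll a X" "IAll a X \<noteq> IAnd \<X>"
  "IAnd \<X> \<noteq> IElt x a" "IElt x a \<noteq> IAnd \<X>"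
  "INot Y \<noteq> IAll a X" "IAll a X \<noteq> INot Y"
  "INot Y \<noteq> IElt x a" "IElt x a \<noteq> INot Y"
  "IAll b Y \<noteq> IElt x a" "IElt x a \<noteq> IAll b Y"
  "IAtm a \<noteq> IComp b Y" "IComp b Y \<noteq> IAtm a"
  by (transfer; auto dest: aeq_shape)+

(* internal_set i carves out level i of the internal sets; IAll may bind an atom of any level. *)
inductive internal_pred :: "'a::atoms ipred \<Rightarrow> bool" and internal_set :: "int \<Rightarrow> 'a iset \<Rightarrow> bool" where
  internal_And: "(\<And>X. X |\<in>| \<X> \<Longrightarrow> internal_pred X) \<Longrightarrow> internal_pred (IAnd \<X>)"
| internal_Not: "internal_pred X \<Longrightarrow> internal_pred (INot X)"
| internal_All: "internal_pred X \<Longrightarrow> internal_pred (IAll a X)"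
| internal_Elt: "a \<in> \<A> (i + 1) \<Longrightarrow> internal_set i x \<Longrightarrow> internal_pred (IElt x a)"
| internal_Atm: "a \<in> \<A> i \<Longrightarrow> internal_set i (IAtm a)"
| internal_Comp: "a \<in> \<A> (i - 1) \<Longrightarrow> internal_pred X \<Longrightarrow> internal_set i (IComp a X)"

(* Graph of substitution: subst_rel_p a x X X' says that X' is X with x substituted for a.
   Bound atoms are chosen fresh for x and, by the permutative convention on atoms, different from a.
   The clause subst_Elt_Comp restarts the substitution on the body of the substituted set, at the
   next lower level. The relation is functional (subst_rel_unique) and, on internal syntax, total
   (subst_total_p, subst_total_s); subst_simps restates its clauses as equations. *)
inductive
  subst_rel_p :: "'a::atoms \<Rightarrow> 'a iset \<Rightarrow> 'a ipred \<Rightarrow> 'a ipred \<Rightarrow> bool" and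
  subst_rel_s :: "'a::atoms \<Rightarrow> 'a iset \<Rightarrow> 'a iset \<Rightarrow> 'a iset \<Rightarrow> bool"
where
  subst_And: "rel_fset (subst_rel_p a x) \<X> \<Y> \<Longrightarrow> subst_rel_p a x (IAnd \<X>) (IAnd \<Y>)"
| subst_Not: "subst_rel_p a x X X' \<Longrightarrow> subst_rel_p a x (INot X) (INot X')"
| subst_All: "b \<noteq> a \<Longrightarrow> b \<notin> fa_s x \<Longrightarrow> subst_rel_p a x X X'
    \<Longrightarrow> subst_rel_p a x (IAll b X) (IAll b X')"
| subst_Elt_Atm: "subst_rel_s a (IAtm n) y y' \<Longrightarrow> subst_rel_p a (IAtm n) (IElt y a) (IElt y' n)"
| subst_Elt_Comp: "a' \<noteq> a \<Longrightarrow> a' \<notin> fa_s y \<Longrightarrow> subst_rel_s a (IComp a' X) y y' \<Longrightarrow> subst_rel_p a' y' X Z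
    \<Longrightarrow> subst_rel_p a (IComp a' X) (IElt y a) Z"
| subst_Elt_other: "b \<noteq> a \<Longrightarrow> subst_rel_s a x y y' \<Longrightarrow> subst_rel_p a x (IElt y b) (IElt y' b)"
| subst_Atm: "subst_rel_s a x (IAtm a) x"
| subst_Atm_other: "b \<noteq> a \<Longrightarrow> subst_rel_s a x (IAtm b) (IAtm b)"
| subst_Comp: "c \<noteq> a \<Longrightarrow> c \<notin> fa_s x \<Longrightarrow> subst_rel_p a x X X'
    \<Longrightarrow> subst_rel_s a x (IComp c X) (IComp c X')"

definition subst_p :: "'a::atoms ipred \<Rightarrow> 'a \<Rightarrow> 'a iset \<Rightarrow> 'a ipred" where
  "subst_p X a x = (THE X'. subst_rel_p a x X X')"
definition subst_s :: "'a::atoms iset \<Rightarrow> 'a \<Rightarrow> 'a iset \<Rightarrow> 'a iset" where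
  "subst_s z a x = (THE z'. subst_rel_s a x z z')"

lemma subst_rel_fa:
  fixes X X' :: "'a::atoms ipred" and z z' x :: "'a iset"
  shows "subst_rel_p a x X X' \<Longrightarrow> fa_p X' \<subseteq> (fa_p X - {a}) \<union> fa_s x"
    and "subst_rel_s a x z z' \<Longrightarrow> fa_s z' \<subseteq> (fa_s z - {a}) \<union> fa_s x"
proof (induction rule: subst_rel_p_subst_rel_s.inducts)
  case (subst_And a x \<X> \<Y>)
  then show ?case by (fastforce simp: rel_fset_alt)
qed (simp_all; blast)+

lemma subst_rel_rename:
  fixes X X' :: "'a::atoms ipred" and z z' x :: "'a iset"
  assumes "level_perm \<pi>"
  shows "subst_rel_p a x X X' \<Longrightarrow> subst_rel_p (\<pi> a) (rename_s \<pi> x) (rename_p \<pi> X) (rename_p \<pi> X')"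
    and "subst_rel_s a x z z' \<Longrightarrow> subst_rel_s (\<pi> a) (rename_s \<pi> x) (rename_s \<pi> z) (rename_s \<pi> z')"
proof (induction rule: subst_rel_p_subst_rel_s.inducts)
  case (subst_And a x \<X> \<Y>)
  then show ?case using assms
    by (auto simp: rename_simps fset.rel_map intro!: subst_rel_p_subst_rel_s.subst_And elim!: fset.rel_mono_strong)
next
  case (subst_Elt_Comp a' a y X y' Z)
  then show ?case using assms level_perm_inj[OF assms]
    by (auto simp: rename_simps fa_rename inj_eq inj_image_mem_iff
        intro!: subst_rel_p_subst_rel_s.subst_Elt_Comp)
qed (use assms level_perm_inj[OF assms] in
     \<open>auto simp: rename_simps fa_rename inj_eq inj_image_mem_iff intro: subst_rel_p_subst_rel_s.intros\<close>)

lemma bind_eqD: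
  assumes "IAll a X = IAll b Y \<or> IComp a X = IComp b Y"
  shows "level b = level a" "b = a \<or> b \<notin> fa_p X" "Y = rename_p (swap b a) X"
    "X = rename_p (swap b a) Y" "a = b \<or> a \<notin> fa_p Y"
proof -
  have *: "bind_eq a X b Y" using assms by (simp add: binder_eq_iff)
  then show l: "level b = level a" and Y: "Y = rename_p (swap b a) X"
    by (simp_all add: bind_eq_def)
  show b: "b = a \<or> b \<notin> fa_p X" using * unfolding bind_eq_def by blast
  have lp: "level_perm (swap b a)" by (rule level_perm_swap[OF l])
  show "X = rename_p (swap b a) Y" unfolding Y by (simp add: rename_comp lp)
  show "a = b \<or> a \<notin> fa_p Y"
    unfolding Y fa_rename(1)[OF lp] using b by (auto simp: Transposition.transpose_def split: if_splits)
qed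

lemma bind_eqI:
  assumes "level b = level a" "b = a \<or> b \<notin> fa_p X"
  shows "IAll a X = IAll b (rename_p (swap b a) X)" "IComp a X = IComp b (rename_p (swap b a) X)"
  using assms by (auto simp: binder_eq_iff bind_eq_def)

inductive_cases subst_AndE: "subst_rel_p a x (IAnd \<X>) Z"
inductive_cases subst_NotE: "subst_rel_p a x (INot X) Z"
inductive_cases subst_AllE: "subst_rel_p a x (IAll b X) Z"
inductive_cases subst_EltE: "subst_rel_p a x (IElt y b) Z"
inductive_cases subst_AtmE: "subst_rel_s a x (IAtm b) z"
inductive_cases subst_CompE: "subst_rel_s a x (IComp b X) z"

lemma binder_subst_unique:
  assumes "b \<noteq> a" "b \<notin> fa_s x" "subst_rel_p a x X X'" "\<And>X2. subst_rel_p a x X X2 \<Longrightarrow> X' = X2"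
    and "c \<noteq> a" "c \<notin> fa_s x" "subst_rel_p a x Y Y'"
    and eq: "IAll b X = IAll c Y \<or> IComp b X = IComp c Y"
  shows "bind_eq b X' c Y'"
proof -
  note e = bind_eqD[OF eq]
  have lp: "level_perm (swap c b)" by (rule level_perm_swap[OF e(1)])
  have "subst_rel_p (swap c b a) (rename_s (swap c b) x) (rename_p (swap c b) Y) (rename_p (swap c b) Y')"
    by (rule subst_rel_rename(1)[OF lp assms(7)])
  moreover have "swap c b a = a" using assms by simp
  moreover have "rename_s (swap c b) x = x" using assms e(1) by (intro rename_s_fresh)
  ultimately have "subst_rel_p a x X (rename_p (swap c b) Y')" using e(4) by metis
  then have "X' = rename_p (swap c b) Y'" by (rule assms(4))
  then have "Y' = rename_p (swap c b) X'" by (simp add: rename_comp lp)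
  moreover have "c \<notin> fa_p X' - {b}"
  proof
    assume "c \<in> fa_p X' - {b}"
    then have "c \<in> fa_p X \<union> fa_s x" "c \<noteq> b" using subst_rel_fa(1)[OF assms(3)] by auto
    then show False using e(2) assms(6) by simp
  qed
  ultimately show ?thesis unfolding bind_eq_def using e(1) by simp
qed

lemma subst_rel_unique:
  fixes X X' :: "'a::atoms ipred" and z z' x :: "'a iset"
  shows "subst_rel_p a x X X' \<Longrightarrow> (\<And>X2. subst_rel_p a x X X2 \<Longrightarrow> X' = X2)"
    and "subst_rel_s a x z z' \<Longrightarrow> (\<And>z2. subst_rel_s a x z z2 \<Longrightarrow> z' = z2)"
proof (induction rule: subst_rel_p_subst_rel_s.inducts)
  case (subst_And a x \<X> \<Y>)
  from subst_And(2) obtain \<Z> where Z: "X2 = IAnd \<Z>" "rel_fset (subst_rel_p a x) \<X> \<Z>"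
    by (rule subst_AndE) simp
  have "\<Y> = \<Z>" using subst_And(1) Z(2) unfolding rel_fset_alt by (intro fset_eqI) metis
  then show ?case using Z by simp
next
  case (subst_Not a x X X')
  from subst_Not.prems show ?case by (rule subst_NotE) (use subst_Not.IH in auto)
next
  case (subst_All b a x X X')
  from subst_All.prems show ?case
  proof (rule subst_AllE)
    fix c Y Y' assume *: "IAll b X = IAll c Y" "X2 = IAll c Y'" "c \<noteq> a" "c \<notin> fa_s x" "subst_rel_p a x Y Y'"
    have "bind_eq b X' c Y'"
      by (rule binder_subst_unique[of b a x X X' c Y Y']) (use subst_All * in blast)+
    then show ?thesis using * by (simp add: binder_eq_iff)
  qed
next
  case (subst_Elt_Atm a n y y')
  from subst_Elt_Atm.prems show ?case
    by (rule subst_EltE) (use subst_Elt_Atm.IH in auto)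
next
  case (subst_Elt_Comp a' a y X y' Z)
  from subst_Elt_Comp.prems show ?case
  proof (rule subst_EltE)
    fix a'' Y y'' assume *: "IComp a' X = IComp a'' Y" "a'' \<noteq> a" "a'' \<notin> fa_s y"
      "subst_rel_s a (IComp a'' Y) y y''" "subst_rel_p a'' y'' Y X2"
    have y: "y'' = y'" using subst_Elt_Comp.IH(1)[of y''] *(1,4) by simp
    note e = bind_eqD[OF disjI2[OF *(1)]]
    have "a' \<notin> fa_s (IComp a' X)" "a'' \<notin> fa_s (IComp a' X)" by (simp, unfold *(1), simp)
    then have f: "a' \<notin> fa_s y'" "a'' \<notin> fa_s y'"
      using subst_rel_fa(2)[OF subst_Elt_Comp.hyps(3)] subst_Elt_Comp.hyps(2) *(3) by blast+
    have lp: "level_perm (swap a'' a')" by (rule level_perm_swap[OF e(1)])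
    have "subst_rel_p (swap a'' a' a'') (rename_s (swap a'' a') y') (rename_p (swap a'' a') Y) (rename_p (swap a'' a') X2)"
      using subst_rel_rename(1)[OF lp *(5)] y by simp
    moreover have "rename_s (swap a'' a') y' = y'" using f e(1) by (intro rename_s_fresh)
    ultimately have "subst_rel_p a' y' X (rename_p (swap a'' a') X2)" using e(4) by simp
    then have Z: "Z = rename_p (swap a'' a') X2" by (rule subst_Elt_Comp.IH(2))
    have "a'' \<notin> fa_p X2" using subst_rel_fa(1)[OF *(5)] f y by blast
    moreover have "a' \<notin> fa_p X2" using subst_rel_fa(1)[OF *(5)] f y e(5) by blast
    ultimately show "Z = X2" using Z rename_fresh e(1) by metis
  qed auto
next
  case (subst_Elt_other b a x y y')
  from subst_Elt_other.prems show ?case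
    by (rule subst_EltE) (use subst_Elt_other in auto)
next
  case (subst_Comp c a x X X')
  from subst_Comp.prems show ?case
  proof (rule subst_CompE)
    fix d Y Y' assume *: "IComp c X = IComp d Y" "z2 = IComp d Y'" "d \<noteq> a" "d \<notin> fa_s x" "subst_rel_p a x Y Y'"
    have "bind_eq c X' d Y'"
      by (rule binder_subst_unique[of c a x X X' d Y Y']) (use subst_Comp * in blast)+
    then show ?thesis using * by (simp add: binder_eq_iff)
  qed
next
  case (subst_Atm a x)
  from subst_Atm.prems show ?case by (rule subst_AtmE) simp_all
next
  case (subst_Atm_other b a x)
  from subst_Atm_other.prems show ?case by (rule subst_AtmE) (use subst_Atm_other.hyps in auto)
qed


lemma subst_p_eqI: "subst_rel_p a x X X' \<Longrightarrow> subst_p X a x = X'"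
  unfolding subst_p_def by (rule the_equality) (auto dest: subst_rel_unique(1))

lemma subst_s_eqI: "subst_rel_s a x z z' \<Longrightarrow> subst_s z a x = z'"
  unfolding subst_s_def by (rule the_equality) (auto dest: subst_rel_unique(2))

lemma internal_rename:
  fixes X :: "'a::atoms ipred" and x :: "'a iset"
  assumes "level_preserving \<pi>"
  shows "internal_pred X \<Longrightarrow> internal_pred (rename_p \<pi> X)"
    and "internal_set i x \<Longrightarrow> internal_set i (rename_s \<pi> x)"
proof (induction rule: internal_pred_internal_set.inducts)
  case (internal_And \<X>)
  then show ?case
    by (auto simp: rename_simps level_preserving_level_perm assms intro!: internal_pred_internal_set.internal_And)
qed (use assms in \<open>auto simp: rename_simps level_preserving_level_perm level_preserving_def \<A>_def
       intro!: internal_pred_internal_set.intros\<close>)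

lemma levels_aeq:
  fixes X Y :: "'a::atoms rpred" and x y :: "'a rset"
  shows "aeq_p X Y \<Longrightarrow> level ` set_rpred X = level ` set_rpred Y"
    and "aeq_s x y \<Longrightarrow> level ` set_rset x = level ` set_rset y"
proof (induction rule: aeq_p_aeq_s.inducts)
  case (aeq_And \<X> \<Y>)
  have "(\<Union>X \<in> fset \<X>. level ` set_rpred X) = (\<Union>X \<in> fset \<Y>. level ` set_rpred X)"
    using aeq_And unfolding rel_fset_alt by fast
  then show ?case by (simp add: image_UN)
next
  case (aeq_All_rename b a X)
  have "level (swap b a c) = level c" for c using level_preserving_swap[OF aeq_All_rename(1)] by (simp add: level_preserving_def)
  then show ?case using aeq_All_rename by (simp add: rpred.set_map image_image)
next
  case (aeq_Comp_rename b a X)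
  have "level (swap b a c) = level c" for c using level_preserving_swap[OF aeq_Comp_rename(1)] by (simp add: level_preserving_def)
  then show ?case using aeq_Comp_rename by (simp add: rpred.set_map image_image)
qed auto

lift_definition levels_p :: "'a::atoms ipred \<Rightarrow> int set" is "\<lambda>R. level ` set_rpred R"
  by (rule levels_aeq)
lift_definition levels_s :: "'a::atoms iset \<Rightarrow> int set" is "\<lambda>r. level ` set_rset r"
  by (rule levels_aeq)

lemma levels_simps [simp]:
  "levels_p (IAnd \<X>) = (\<Union>X \<in> fset \<X>. levels_p X)"
  "levels_p (INot X) = levels_p X"
  "levels_p (IAll a X) = insert (level a) (levels_p X)"
  "levels_p (IElt x a) = insert (level a) (levels_s x)"
  "levels_s (IAtm a) = {level a}"
  "levels_s (IComp a X) = insert (level a) (levels_p X)"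
proof -
  show "levels_p (IAnd \<X>) = (\<Union>X \<in> fset \<X>. levels_p X)"
    using ipred_fset_abs[of \<X>] by (auto simp: IAnd_abs levels_p.abs_eq image_UN) (auto simp: image_iff)
qed (transfer; auto)+

lemma levels_rename:
  assumes "level_preserving \<pi>"
  shows "levels_p (rename_p \<pi> X) = levels_p X"
proof -
  obtain R where R: "X = abs_ipred R" using ipred_ex_abs by blast
  show ?thesis using assms
    by (simp add: R rename_abs level_preserving_level_perm levels_p.abs_eq rpred.set_map image_image level_preserving_def)
qed

lemma finite_levels: "finite (levels_p X)" "finite (levels_s x)"
  by (transfer, simp add: finite_set_raw, transfer, simp add: finite_set_raw)

lemma ex_fresh_binder:
  fixes F :: "'a::atoms set"
  assumes "finite F"
  obtains c where "level c = level a" "c \<notin> F" "IAll a X = IAll c (rename_p (swap c a) X)"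
    "IComp a X = IComp c (rename_p (swap c a) X)"
proof -
  have "finite (F \<union> fa_p X)" using assms by simp
  then obtain c where "level c = level a" "c \<notin> F \<union> fa_p X" by (rule ex_fresh)
  then show ?thesis using that bind_eqI by blast
qed

lemma subst_ex_step:
  fixes x z :: "'a::atoms iset" and X :: "'a ipred"
  assumes IH: "\<forall>(b::'a) y Y. m \<le> i \<longrightarrow> b \<in> \<A> (i - 1) \<longrightarrow> internal_set (i - 1) y \<longrightarrow> levels_s y \<subseteq> {m..}
       \<longrightarrow> internal_pred Y \<longrightarrow> levels_p Y \<subseteq> {m..}
       \<longrightarrow> (\<exists>Z. subst_rel_p b y Y Z \<and> internal_pred Z \<and> levels_p Z \<subseteq> {m..})"
    and a: "a \<in> \<A> i" and x: "internal_set i x" "levels_s x \<subseteq> {m..}"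
  shows "internal_pred X \<Longrightarrow> levels_p X \<subseteq> {m..} \<longrightarrow> (\<forall>\<pi>. level_preserving \<pi> \<longrightarrow>
           (\<exists>X'. subst_rel_p a x (rename_p \<pi> X) X' \<and> internal_pred X' \<and> levels_p X' \<subseteq> {m..}))"
    and "internal_set j z \<Longrightarrow> levels_s z \<subseteq> {m..} \<longrightarrow> (\<forall>\<pi>. level_preserving \<pi> \<longrightarrow>
           (\<exists>z'. subst_rel_s a x (rename_s \<pi> z) z' \<and> internal_set j z' \<and> levels_s z' \<subseteq> {m..}))"
proof (induction rule: internal_pred_internal_set.inducts)
  case (internal_And \<X>)
  show ?case
  proof (intro impI allI)
    fix \<pi> :: "'a \<Rightarrow> 'a"
    assume m: "levels_p (IAnd \<X>) \<subseteq> {m..}" and \<pi>: "level_preserving \<pi>"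
    have "\<forall>X. \<exists>X'. X |\<in>| \<X> \<longrightarrow> subst_rel_p a x (rename_p \<pi> X) X' \<and> internal_pred X' \<and> levels_p X' \<subseteq> {m..}"
      using internal_And.IH m \<pi> by fastforce
    then obtain f where f: "\<And>X. X |\<in>| \<X> \<Longrightarrow>
        subst_rel_p a x (rename_p \<pi> X) (f X) \<and> internal_pred (f X) \<and> levels_p (f X) \<subseteq> {m..}"
      by metis
    have "rel_fset (subst_rel_p a x) (rename_p \<pi> |`| \<X>) (f |`| \<X>)"
      using f by (auto simp: fset.rel_map intro!: fset.rel_refl_strong)
    then have "subst_rel_p a x (rename_p \<pi> (IAnd \<X>)) (IAnd (f |`| \<X>))"
      using \<pi> by (simp add: rename_simps level_preserving_level_perm subst_And)
    moreover have "internal_pred (IAnd (f |`| \<X>))"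
      using f by (auto intro: internal_pred_internal_set.internal_And)
    moreover have "levels_p (IAnd (f |`| \<X>)) \<subseteq> {m..}" using f by fastforce
    ultimately show "\<exists>X'. subst_rel_p a x (rename_p \<pi> (IAnd \<X>)) X' \<and> internal_pred X' \<and> levels_p X' \<subseteq> {m..}"
      by blast
  qed
next
  case (internal_Not X)
  show ?case
  proof (intro impI allI)
    fix \<pi> :: "'a \<Rightarrow> 'a"
    assume "levels_p (INot X) \<subseteq> {m..}" and \<pi>: "level_preserving \<pi>"
    then obtain X' where "subst_rel_p a x (rename_p \<pi> X) X'" "internal_pred X'" "levels_p X' \<subseteq> {m..}"
      using internal_Not.IH by auto
    then show "\<exists>X'. subst_rel_p a x (rename_p \<pi> (INot X)) X' \<and> internal_pred X' \<and> levels_p X' \<subseteq> {m..}"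
      using \<pi> by (intro exI[of _ "INot X'"])
        (simp add: rename_simps level_preserving_level_perm subst_Not internal_pred_internal_set.internal_Not)
  qed
next
  case (internal_All X b)
  show ?case
  proof (intro impI allI)
    fix \<pi> :: "'a \<Rightarrow> 'a"
    assume m: "levels_p (IAll b X) \<subseteq> {m..}" and \<pi>: "level_preserving \<pi>"
    have "finite (insert a (fa_s x))" by simp
    then obtain c where c: "level c = level (\<pi> b)" "c \<notin> insert a (fa_s x)"
      "IAll (\<pi> b) (rename_p \<pi> X) = IAll c (rename_p (swap c (\<pi> b)) (rename_p \<pi> X))"
      by (rule ex_fresh_binder)
    have p: "level_preserving (swap c (\<pi> b) \<circ> \<pi>)" by (intro level_preserving_comp level_preserving_swap c \<pi>)
    then obtain X' where X': "subst_rel_p a x (rename_p (swap c (\<pi> b) \<circ> \<pi>) X) X'" "internal_pred X'" "levels_p X' \<subseteq> {m..}"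
      using internal_All.IH m by auto
    have "subst_rel_p a x (IAll c (rename_p (swap c (\<pi> b) \<circ> \<pi>) X)) (IAll c X')"
      using c(2) X'(1) by (intro subst_All) auto
    moreover have "rename_p \<pi> (IAll b X) = IAll c (rename_p (swap c (\<pi> b) \<circ> \<pi>) X)"
      using c \<pi> by (simp add: rename_simps level_preserving_level_perm rename_comp level_perm_swap)
    moreover have "level c \<ge> m" using c(1) \<pi> m by (simp add: level_preserving_def)
    ultimately show "\<exists>X'. subst_rel_p a x (rename_p \<pi> (IAll b X)) X' \<and> internal_pred X' \<and> levels_p X' \<subseteq> {m..}"
      using X' by (intro exI[of _ "IAll c X'"]) (simp add: internal_pred_internal_set.internal_All)
  qed
next
  case (internal_Elt d k y)
  show ?case
  proof (intro impI allI)
    fix \<pi> :: "'a \<Rightarrow> 'a"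
    assume m: "levels_p (IElt y d) \<subseteq> {m..}" and \<pi>: "level_preserving \<pi>"
    then obtain y' where y': "subst_rel_s a x (rename_s \<pi> y) y'" "internal_set k y'" "levels_s y' \<subseteq> {m..}"
      using internal_Elt.IH by auto
    have \<pi>d: "level (\<pi> d) = k + 1" "m \<le> k + 1"
      using \<pi> m internal_Elt.hyps(1) by (auto simp: level_preserving_def \<A>_def)
    have ren: "rename_p \<pi> (IElt y d) = IElt (rename_s \<pi> y) (\<pi> d)"
      using \<pi> by (simp add: rename_simps level_preserving_level_perm)
    show "\<exists>X'. subst_rel_p a x (rename_p \<pi> (IElt y d)) X' \<and> internal_pred X' \<and> levels_p X' \<subseteq> {m..}"
    proof (cases "\<pi> d = a")
      case False
      have "internal_pred (IElt y' (\<pi> d))"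
        using y' \<pi>d by (intro internal_pred_internal_set.internal_Elt[of _ k]) (simp_all add: \<A>_def)
      then show ?thesis unfolding ren using False y' \<pi>d
        by (intro exI[of _ "IElt y' (\<pi> d)"]) (simp add: subst_Elt_other)
    next
      case True
      then have k: "i = k + 1" using a \<pi>d by (simp add: \<A>_def)
      from x(1) show ?thesis
      proof (cases rule: internal_set.cases)
        case (internal_Atm n)
        have "internal_pred (IElt y' n)"
          using y' internal_Atm k by (intro internal_pred_internal_set.internal_Elt[of _ k]) simp_all
        then show ?thesis unfolding ren True using y' internal_Atm x(2)
          by (intro exI[of _ "IElt y' n"]) (simp add: subst_Elt_Atm)
      next
        case (internal_Comp b Y)
        have "finite (insert a (fa_s (rename_s \<pi> y)))" by simp
        then obtain c where c: "level c = level b" "c \<notin> insert a (fa_s (rename_s \<pi> y))"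
          "IComp b Y = IComp c (rename_p (swap c b) Y)"
          by (rule ex_fresh_binder)
        let ?Y = "rename_p (swap c b) Y"
        have p: "level_preserving (swap c b)" by (rule level_preserving_swap[OF c(1)])
        have "\<exists>Z. subst_rel_p c y' ?Y Z \<and> internal_pred Z \<and> levels_p Z \<subseteq> {m..}"
        proof (rule IH[rule_format])
          show "m \<le> i" using \<pi>d k by simp
          show "c \<in> \<A> (i - 1)" using c(1) internal_Comp by (simp add: \<A>_def)
          show "internal_set (i - 1) y'" using y' k by simp
          show "levels_s y' \<subseteq> {m..}" by (rule y')
          show "internal_pred ?Y" by (rule internal_rename(1)[OF p]) (rule internal_Comp)
          show "levels_p ?Y \<subseteq> {m..}" using x(2) internal_Comp by (simp add: levels_rename[OF p])
        qed
        moreover have "x = IComp c ?Y" using internal_Comp(1) c(3) by simp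
        ultimately show ?thesis unfolding ren True using c(2) y'(1)
          by (metis insert_iff subst_Elt_Comp)
      qed
    qed
  qed
next
  case (internal_Atm b k)
  show ?case
  proof (intro impI allI)
    fix \<pi> :: "'a \<Rightarrow> 'a"
    assume m: "levels_s (IAtm b) \<subseteq> {m..}" and \<pi>: "level_preserving \<pi>"
    have l: "level (\<pi> b) = k" "rename_s \<pi> (IAtm b) = IAtm (\<pi> b)"
      using \<pi> internal_Atm by (auto simp: level_preserving_def \<A>_def rename_simps level_preserving_level_perm)
    show "\<exists>z'. subst_rel_s a x (rename_s \<pi> (IAtm b)) z' \<and> internal_set k z' \<and> levels_s z' \<subseteq> {m..}"
    proof (cases "\<pi> b = a")
      case True
      then have "k = i" using l a by (simp add: \<A>_def)
      then show ?thesis unfolding l True using x subst_Atm by blast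
    next
      case False
      have "internal_set k (IAtm (\<pi> b))"
        using l by (intro internal_pred_internal_set.internal_Atm) (simp add: \<A>_def)
      moreover have "level (\<pi> b) \<ge> m" using \<pi> m by (simp add: level_preserving_def)
      ultimately show ?thesis unfolding l(2) using False subst_Atm_other
        by (intro exI[of _ "IAtm (\<pi> b)"]) simp
    qed
  qed
next
  case (internal_Comp b k X)
  show ?case
  proof (intro impI allI)
    fix \<pi> :: "'a \<Rightarrow> 'a"
    assume m: "levels_s (IComp b X) \<subseteq> {m..}" and \<pi>: "level_preserving \<pi>"
    have "finite (insert a (fa_s x))" by simp
    then obtain c where c: "level c = level (\<pi> b)" "c \<notin> insert a (fa_s x)"
      "IComp (\<pi> b) (rename_p \<pi> X) = IComp c (rename_p (swap c (\<pi> b)) (rename_p \<pi> X))"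
      by (rule ex_fresh_binder)
    have p: "level_preserving (swap c (\<pi> b) \<circ> \<pi>)" by (intro level_preserving_comp level_preserving_swap c \<pi>)
    then obtain X' where X': "subst_rel_p a x (rename_p (swap c (\<pi> b) \<circ> \<pi>) X) X'" "internal_pred X'" "levels_p X' \<subseteq> {m..}"
      using internal_Comp.IH m by auto
    have "subst_rel_s a x (IComp c (rename_p (swap c (\<pi> b) \<circ> \<pi>) X)) (IComp c X')"
      using c(2) X'(1) by (intro subst_Comp) auto
    moreover have "rename_s \<pi> (IComp b X) = IComp c (rename_p (swap c (\<pi> b) \<circ> \<pi>) X)"
      using c \<pi> by (simp add: rename_simps level_preserving_level_perm rename_comp level_perm_swap)
    moreover have "level c \<ge> m" using c(1) \<pi> m by (simp add: level_preserving_def)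
    moreover have "c \<in> \<A> (k - 1)" using c(1) \<pi> internal_Comp.hyps(1) by (simp add: level_preserving_def \<A>_def)
    ultimately show "\<exists>z'. subst_rel_s a x (rename_s \<pi> (IComp b X)) z' \<and> internal_set k z' \<and> levels_s z' \<subseteq> {m..}"
      using X' by (intro exI[of _ "IComp c X'"]) (simp add: internal_pred_internal_set.internal_Comp)
  qed
qed

lemma subst_ex_bounded:
  fixes x :: "'a::atoms iset" and z :: "'a iset" and X :: "'a ipred"
  assumes "i - m < int n" "a \<in> \<A> i" "internal_set i x" "levels_s x \<subseteq> {m..}"
  shows "internal_pred X \<Longrightarrow> levels_p X \<subseteq> {m..}
      \<Longrightarrow> \<exists>X'. subst_rel_p a x X X' \<and> internal_pred X' \<and> levels_p X' \<subseteq> {m..}"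
    and "internal_set j z \<Longrightarrow> levels_s z \<subseteq> {m..}
      \<Longrightarrow> \<exists>z'. subst_rel_s a x z z' \<and> internal_set j z' \<and> levels_s z' \<subseteq> {m..}"
proof -
  have *: "(internal_pred X \<longrightarrow> levels_p X \<subseteq> {m..} \<longrightarrow>
         (\<exists>X'. subst_rel_p a x X X' \<and> internal_pred X' \<and> levels_p X' \<subseteq> {m..})) \<and>
      (internal_set j z \<longrightarrow> levels_s z \<subseteq> {m..} \<longrightarrow>
         (\<exists>z'. subst_rel_s a x z z' \<and> internal_set j z' \<and> levels_s z' \<subseteq> {m..}))"
    using assms
  proof (induction n arbitrary: i a x X j z)
    case 0
    have IH: "\<forall>(b::'a) y Y. m \<le> i \<longrightarrow> b \<in> \<A> (i - 1) \<longrightarrow> internal_set (i - 1) y \<longrightarrow> levels_s y \<subseteq> {m..}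
       \<longrightarrow> internal_pred Y \<longrightarrow> levels_p Y \<subseteq> {m..}
       \<longrightarrow> (\<exists>Z. subst_rel_p b y Y Z \<and> internal_pred Z \<and> levels_p Z \<subseteq> {m..})"
      using 0(1) by simp
    show ?case
    proof (intro conjI impI)
      assume "internal_pred X" "levels_p X \<subseteq> {m..}"
      from subst_ex_step(1)[OF IH 0(2-4) this(1), THEN mp, OF this(2), rule_format, OF level_preserving_id(1)]
      show "\<exists>X'. subst_rel_p a x X X' \<and> internal_pred X' \<and> levels_p X' \<subseteq> {m..}" by simp
    next
      assume "internal_set j z" "levels_s z \<subseteq> {m..}"
      from subst_ex_step(2)[OF IH 0(2-4) this(1), THEN mp, OF this(2), rule_format, OF level_preserving_id(1)]
      show "\<exists>z'. subst_rel_s a x z z' \<and> internal_set j z' \<and> levels_s z' \<subseteq> {m..}" by simp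
    qed
  next
    case (Suc n)
    have IH: "\<forall>(b::'a) y Y. m \<le> i \<longrightarrow> b \<in> \<A> (i - 1) \<longrightarrow> internal_set (i - 1) y \<longrightarrow> levels_s y \<subseteq> {m..}
       \<longrightarrow> internal_pred Y \<longrightarrow> levels_p Y \<subseteq> {m..}
       \<longrightarrow> (\<exists>Z. subst_rel_p b y Y Z \<and> internal_pred Z \<and> levels_p Z \<subseteq> {m..})"
      using Suc.IH[of "i - 1"] Suc.prems(1) by simp
    show ?case
    proof (intro conjI impI)
      assume "internal_pred X" "levels_p X \<subseteq> {m..}"
      from subst_ex_step(1)[OF IH Suc.prems(2-4) this(1), THEN mp, OF this(2), rule_format, OF level_preserving_id(1)]
      show "\<exists>X'. subst_rel_p a x X X' \<and> internal_pred X' \<and> levels_p X' \<subseteq> {m..}" by simp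
    next
      assume "internal_set j z" "levels_s z \<subseteq> {m..}"
      from subst_ex_step(2)[OF IH Suc.prems(2-4) this(1), THEN mp, OF this(2), rule_format, OF level_preserving_id(1)]
      show "\<exists>z'. subst_rel_s a x z z' \<and> internal_set j z' \<and> levels_s z' \<subseteq> {m..}" by simp
    qed
  qed
  show "\<exists>X'. subst_rel_p a x X X' \<and> internal_pred X' \<and> levels_p X' \<subseteq> {m..}"
    if "internal_pred X" "levels_p X \<subseteq> {m..}"
    using *[THEN conjunct1, rule_format, OF that] .
  show "\<exists>z'. subst_rel_s a x z z' \<and> internal_set j z' \<and> levels_s z' \<subseteq> {m..}"
    if "internal_set j z" "levels_s z \<subseteq> {m..}"
    using *[THEN conjunct2, rule_format, OF that] .
qed

lemma levels_bounded: "\<exists>m. levels_s x \<union> levels_s z \<union> levels_p X \<subseteq> {m..}"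
proof -
  let ?L = "levels_s x \<union> levels_s z \<union> levels_p X"
  have fin: "finite ?L" by (simp add: finite_levels)
  have "?L \<subseteq> {Min ?L..}"
  proof
    fix l assume "l \<in> ?L"
    then show "l \<in> {Min ?L..}" using Min_le[OF fin] by simp
  qed
  then show ?thesis by blast
qed

lemma subst_total_p:
  assumes "a \<in> \<A> i" "internal_set i x" "internal_pred X"
  shows "subst_rel_p a x X (subst_p X a x)" "internal_pred (subst_p X a x)"
proof -
  obtain m where m: "levels_s x \<subseteq> {m..}" "levels_p X \<subseteq> {m..}" using levels_bounded[of x x X] by auto
  have "i - m < int (nat (i - m + 1))" by simp
  then obtain X' where "subst_rel_p a x X X'" "internal_pred X'"
    using subst_ex_bounded(1)[OF _ assms(1,2) m(1) assms(3) m(2)] by blast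
  then show "subst_rel_p a x X (subst_p X a x)" "internal_pred (subst_p X a x)"
    by (simp_all add: subst_p_eqI)
qed

lemma subst_total_s:
  assumes "a \<in> \<A> i" "internal_set i x" "internal_set j z"
  shows "subst_rel_s a x z (subst_s z a x)" "internal_set j (subst_s z a x)"
proof -
  obtain m where m: "levels_s x \<subseteq> {m..}" "levels_s z \<subseteq> {m..}" using levels_bounded[of x z "INot undefined"] by auto
  have "i - m < int (nat (i - m + 1))" by simp
  then obtain z' where "subst_rel_s a x z z'" "internal_set j z'"
    using subst_ex_bounded(2)[OF _ assms(1,2) m(1) assms(3) m(2)] by blast
  then show "subst_rel_s a x z (subst_s z a x)" "internal_set j (subst_s z a x)"
    by (simp_all add: subst_s_eqI)
qed

lemma subst_simps:
  fixes x y :: "'a::atoms iset"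
  assumes "a \<in> \<A> i" "internal_set i x"
  shows "(\<And>X. X |\<in>| \<X> \<Longrightarrow> internal_pred X) \<Longrightarrow>
      subst_p (IAnd \<X>) a x = IAnd ((\<lambda>X. subst_p X a x) |`| \<X>)"
    and "internal_pred X \<Longrightarrow> subst_p (INot X) a x = INot (subst_p X a x)"
    and "internal_pred X \<Longrightarrow> b \<noteq> a \<Longrightarrow> b \<notin> fa_s x \<Longrightarrow> subst_p (IAll b X) a x = IAll b (subst_p X a x)"
    and "internal_set j y \<Longrightarrow> x = IAtm n \<Longrightarrow> subst_p (IElt y a) a x = IElt (subst_s y a x) n"
    and "internal_set (i - 1) y \<Longrightarrow> x = IComp a' X' \<Longrightarrow> internal_pred X' \<Longrightarrow> a' \<notin> fa_s y \<Longrightarrow>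
      subst_p (IElt y a) a x = subst_p X' a' (subst_s y a x)"
    and "internal_set j y \<Longrightarrow> b \<noteq> a \<Longrightarrow> subst_p (IElt y b) a x = IElt (subst_s y a x) b"
    and "subst_s (IAtm a) a x = x"
    and "b \<noteq> a \<Longrightarrow> subst_s (IAtm b) a x = IAtm b"
    and "internal_pred X \<Longrightarrow> c \<noteq> a \<Longrightarrow> c \<notin> fa_s x \<Longrightarrow> subst_s (IComp c X) a x = IComp c (subst_p X a x)"
proof -
  note P = subst_total_p(1)[OF assms] and S = subst_total_s(1)[OF assms]
  show "subst_p (IAnd \<X>) a x = IAnd ((\<lambda>X. subst_p X a x) |`| \<X>)"
    if "\<And>X. X |\<in>| \<X> \<Longrightarrow> internal_pred X"
  proof (rule subst_p_eqI, rule subst_And)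
    show "rel_fset (subst_rel_p a x) \<X> ((\<lambda>X. subst_p X a x) |`| \<X>)"
      using that P by (auto simp: rel_fset_alt)
  qed
  show "internal_pred X \<Longrightarrow> subst_p (INot X) a x = INot (subst_p X a x)"
    by (rule subst_p_eqI, rule subst_Not, rule P)
  show "internal_pred X \<Longrightarrow> b \<noteq> a \<Longrightarrow> b \<notin> fa_s x \<Longrightarrow> subst_p (IAll b X) a x = IAll b (subst_p X a x)"
    by (rule subst_p_eqI, rule subst_All) (auto intro: P)
  show "subst_p (IElt y a) a x = IElt (subst_s y a x) n" if "internal_set j y" "x = IAtm n"
    using subst_Elt_Atm[of a n y] S[OF that(1)] that(2) by (auto intro: subst_p_eqI)
  show "subst_p (IElt y a) a x = subst_p X' a' (subst_s y a x)"
    if y: "internal_set (i - 1) y" and x: "x = IComp a' X'" and X': "internal_pred X'" and f: "a' \<notin> fa_s y"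
  proof (rule subst_p_eqI, subst x, rule subst_Elt_Comp)
    from assms(2) have a': "a' \<in> \<A> (i - 1)" unfolding x
    proof (cases rule: internal_set.cases)
      case (internal_Comp b Y)
      then have "level a' = level b" using bind_eqD(1)[of b Y a' X'] by simp
      then show ?thesis using internal_Comp by (simp add: \<A>_def)
    qed simp
    then show "a' \<noteq> a" using assms(1) by (auto simp: \<A>_def)
    show "a' \<notin> fa_s y" by (rule f)
    show "subst_rel_s a (IComp a' X') y (subst_s y a x)" using S[OF y] x by simp
    show "subst_rel_p a' (subst_s y a x) X' (subst_p X' a' (subst_s y a x))"
      by (rule subst_total_p(1)[OF a' subst_total_s(2)[OF assms y] X'])
  qed
  show "internal_set j y \<Longrightarrow> b \<noteq> a \<Longrightarrow> subst_p (IElt y b) a x = IElt (subst_s y a x) b"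
    by (rule subst_p_eqI, rule subst_Elt_other) (auto intro: S)
  show "subst_s (IAtm a) a x = x" by (rule subst_s_eqI, rule subst_Atm)
  show "b \<noteq> a \<Longrightarrow> subst_s (IAtm b) a x = IAtm b" by (rule subst_s_eqI, rule subst_Atm_other)
  show "internal_pred X \<Longrightarrow> c \<noteq> a \<Longrightarrow> c \<notin> fa_s x \<Longrightarrow> subst_s (IComp c X) a x = IComp c (subst_p X a x)"
    by (rule subst_s_eqI, rule subst_Comp) (auto intro: P)
qed

definition \<L> :: "int \<Rightarrow> 'a::atoms iset set" where
  "\<L> i = {x. internal_set i x}"

(* Concretion; by conc_IComp it is determined for b of the level of the bound atom and not free
   in x. *)
definition conc :: "'a::atoms iset \<Rightarrow> 'a \<Rightarrow> 'a ipred" where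
  "conc x b = (THE Y. \<exists>a X. x = IComp a X \<and> Y = rename_p (swap b a) X)"

(* The internal predicate expressing that y belongs to x. The choice of the fresh atom is
   irrelevant: see ielem_IComp. *)
definition ielem :: "'a::atoms iset \<Rightarrow> 'a iset \<Rightarrow> 'a ipred" where
  "ielem y x =
     (if \<exists>a. x = IAtm a then IElt y (THE a. x = IAtm a)
      else let b = (SOME b. (\<exists>a X. x = IComp a X \<and> level b = level a) \<and> b \<notin> fa_s x \<and> b \<notin> fa_s y)
           in subst_p (conc x b) b y)"

lemma conc_IComp:
  assumes "level b = level a" "b \<notin> fa_s (IComp a X)"
  shows "conc (IComp a X) b = rename_p (swap b a) X"
  unfolding conc_def
proof (rule the_equality)
  fix Y assume "\<exists>a' X'. IComp a X = IComp a' X' \<and> Y = rename_p (swap b a') X'"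
  then obtain a' X' where *: "IComp a X = IComp a' X'" "Y = rename_p (swap b a') X'" by blast
  note e = bind_eqD[OF disjI2[OF *(1)]]
  have "IComp a X = IComp b (rename_p (swap b a) X)"
    using assms by (intro bind_eqI) auto
  moreover have "IComp a' X' = IComp b (rename_p (swap b a') X')"
    using assms e(1) unfolding *(1) by (intro bind_eqI) auto
  ultimately have "IComp b (rename_p (swap b a) X) = IComp b Y" using * by simp
  then have "Y = rename_p (swap b b) (rename_p (swap b a) X)" using bind_eqD(3) by metis
  then show "Y = rename_p (swap b a) X" by simp
qed blast

lemma ielem_IAtm: "ielem y (IAtm a) = IElt y a"
  by (simp add: ielem_def)

lemma ielem_IComp:
  assumes "a \<in> \<A> i" "internal_pred X" "internal_set i y" "a \<notin> fa_s y"
  shows "ielem y (IComp a X) = subst_p X a y"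
proof -
  let ?x = "IComp a X"
  define b where "b = (SOME b. (\<exists>a' X'. ?x = IComp a' X' \<and> level b = level a') \<and> b \<notin> fa_s ?x \<and> b \<notin> fa_s y)"
  have "(\<exists>a' X'. ?x = IComp a' X' \<and> level b = level a') \<and> b \<notin> fa_s ?x \<and> b \<notin> fa_s y"
    unfolding b_def by (rule someI[of _ a]) (use assms(4) in auto)
  then obtain a' X' where *: "?x = IComp a' X'" "level b = level a'" and b: "b \<notin> fa_s ?x" "b \<notin> fa_s y"
    by blast
  have l: "level b = level a" using *(2) bind_eqD(1)[OF disjI2[OF *(1)]] by simp
  have lp: "level_perm (swap b a)" by (rule level_perm_swap[OF l])
  let ?Z = "subst_p X a y"
  have Z: "subst_rel_p a y X ?Z" by (rule subst_total_p[OF assms(1,3,2)])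
  have "rename_s (swap b a) y = y" using l b assms(4) by (intro rename_s_fresh)
  then have "subst_rel_p b y (rename_p (swap b a) X) (rename_p (swap b a) ?Z)"
    using subst_rel_rename(1)[OF lp Z] by simp
  moreover have "rename_p (swap b a) ?Z = ?Z"
  proof (cases "b = a")
    case False
    then show ?thesis using subst_rel_fa(1)[OF Z] b assms(4) l by (intro rename_fresh) auto
  qed simp
  ultimately have "subst_p (conc ?x b) b y = ?Z"
    by (simp add: conc_IComp[OF l b(1)] subst_p_eqI)
  moreover have "\<not> (\<exists>c. ?x = IAtm c)" by simp
  then have "ielem y ?x = subst_p (conc ?x b) b y"
    unfolding ielem_def Let_def b_def by (simp only: if_False)
  ultimately show ?thesis by simp
qed

definition prepoint :: "('a::atoms \<times> 'a iset) set \<Rightarrow> bool" where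
  "prepoint p \<longleftrightarrow> p \<subseteq> (\<Union>i. \<A> i \<times> \<L> (i - 1))"

definition extension :: "('a::atoms \<times> 'a iset) set \<Rightarrow> 'a iset \<Rightarrow> 'a iset set" where
  "extension p x = {y. \<exists>i. x \<in> \<L> (i + 1) \<and> y \<in> \<L> i \<and> p \<Turnstile> ielem y x}"

definition ext_eq :: "('a::atoms \<times> 'a iset) set \<Rightarrow> 'a iset \<Rightarrow> 'a iset \<Rightarrow> bool" where
  "ext_eq p u u' \<longleftrightarrow> extension p u = extension p u'"

(* The parameter i is the common level of u and u'. *)
definition int_eq :: "('a::atoms \<times> 'a iset) set \<Rightarrow> int \<Rightarrow> 'a iset \<Rightarrow> 'a iset \<Rightarrow> bool" where
  "int_eq p i u u' \<longleftrightarrow>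
     (\<forall>j. \<forall>b \<in> \<A> (j + 1). \<forall>c \<in> \<A> i. \<forall>y \<in> \<L> j. (b, subst_s y c u) \<in> p \<longleftrightarrow> (b, subst_s y c u') \<in> p)"

definition generously_names :: "('a::atoms \<times> 'a iset) set \<Rightarrow> int \<Rightarrow> 'a iset \<Rightarrow> bool" where
  "generously_names p i x \<longleftrightarrow>
     (\<forall>a \<in> \<A> i. \<forall>X. internal_pred X \<longrightarrow>
        generous {a' \<in> \<A> i. p \<Turnstile> rename_p (swap a' a) X \<longleftrightarrow> p \<Turnstile> subst_p X a x})"

definition extensional :: "('a::atoms \<times> 'a iset) set \<Rightarrow> bool" where
  "extensional p \<longleftrightarrow> (\<forall>i. \<forall>x \<in> \<L> i. \<forall>x' \<in> \<L> i. ext_eq p x x' \<longrightarrow> int_eq p i x x')"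

definition shift_perm :: "('a::atoms \<Rightarrow> 'a) \<Rightarrow> bool" where
  "shift_perm \<theta> \<longleftrightarrow> bij \<theta> \<and> (\<forall>i. \<theta> ` \<A> i = \<A> (i + 1))"

definition rename_prepoint :: "('a \<Rightarrow> 'a) \<Rightarrow> ('a::atoms \<times> 'a iset) set \<Rightarrow> ('a \<times> 'a iset) set" where
  "rename_prepoint \<theta> p = {(\<theta> a, rename_s \<theta> x) | a x. (a, x) \<in> p}"

definition ambiguous :: "('a::atoms \<times> 'a iset) set \<Rightarrow> bool" where
  "ambiguous p \<longleftrightarrow> (\<exists>\<theta>. shift_perm \<theta> \<and> rename_prepoint \<theta> p = p)"

definition point :: "('a::atoms \<times> 'a iset) set \<Rightarrow> bool" where
  "point p \<longleftrightarrow> prepoint p \<and> extensional p \<and> ambiguous p \<and>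
     (\<forall>i. \<forall>x \<in> \<L> i. generously_names p i x)"

definition points_of :: "'a::atoms ipred \<Rightarrow> ('a \<times> 'a iset) set set" where
  "points_of Y = {p. point p \<and> p \<Turnstile> Y}"

lemma shift_perm_level_perm: "shift_perm \<theta> \<Longrightarrow> level_perm \<theta>"
proof -
  assume \<theta>: "shift_perm \<theta>"
  have "level (\<theta> a) = level a + 1" for a
  proof -
    have "\<theta> a \<in> \<theta> ` \<A> (level a)" by (rule imageI) (simp add: \<A>_def)
    also have "\<dots> = \<A> (level a + 1)" using \<theta> by (simp add: shift_perm_def)
    finally show ?thesis by (simp add: \<A>_def)
  qed
  then show ?thesis using \<theta> by (simp add: shift_perm_def level_perm_def)
qed

end

theory Submission
  imports Defs
begin

(* If p validates the universal quantification, the atoms a' with p validating (a' a) . X have small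
   complement, so they meet the generous set of atoms that name x, whence p validates X[a := x].
   Conversely, substituting atm(a') for a in X is the renaming (a' a) . X whenever a' is fresh, and
   all but finitely many a' are fresh. *)

text \<open>Any two sets satisfying \<open>is_beth_omega\<close> are equipollent, so none of them
  lies strictly below another.\<close>

lemma not_small_generous:
  assumes "generous (S :: 'a set)"
  shows "\<not> small S"
proof
  assume "small S"
  then obtain B :: "'a set" where "is_beth_omega B" "S \<prec> B" unfolding small_def by blast
  moreover from this have "S \<approx> B"
    using assms is_beth_omega_eqpoll unfolding generous_def by blast
  ultimately show False by (simp add: lesspoll_def)
qed

(* Quantifying over the renamings keeps the induction hypothesis applicable after a bound atom has
   been renamed away from a and n. *)
lemma subst_rel_IAtm_rename:
  fixes a n :: "'a::atoms" and X :: "'a ipred" and z :: "'a iset"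
  assumes l: "level n = level a" and ne: "n \<noteq> a"
  shows "internal_pred X \<Longrightarrow> \<forall>\<pi>. level_preserving \<pi> \<longrightarrow> n \<notin> fa_p (rename_p \<pi> X) \<longrightarrow>
           subst_rel_p a (IAtm n) (rename_p \<pi> X) (rename_p (swap n a) (rename_p \<pi> X))"
    and "internal_set j z \<Longrightarrow> \<forall>\<pi>. level_preserving \<pi> \<longrightarrow> n \<notin> fa_s (rename_s \<pi> z) \<longrightarrow>
           subst_rel_s a (IAtm n) (rename_s \<pi> z) (rename_s (swap n a) (rename_s \<pi> z))"
proof (induction rule: internal_pred_internal_set.inducts)
  note lp = level_perm_swap[OF l]
  \<comment> \<open>Serves both binders. The bound atom is renamed to some \<open>c\<close> other
    than \<open>a\<close> and \<open>n\<close>, which is what \<open>subst_All\<close> and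
    \<open>subst_Comp\<close> demand when \<open>IAtm n\<close> replaces \<open>a\<close>.\<close>
  have bound: "\<exists>c Y. c \<noteq> a \<and> c \<noteq> n
      \<and> rename_p \<pi> (IAll b X) = IAll c Y \<and> rename_s \<pi> (IComp b X) = IComp c Y
      \<and> subst_rel_p a (IAtm n) Y (rename_p (swap n a) Y)"
    if IH: "\<forall>\<pi>. level_preserving \<pi> \<longrightarrow> n \<notin> fa_p (rename_p \<pi> X) \<longrightarrow>
           subst_rel_p a (IAtm n) (rename_p \<pi> X) (rename_p (swap n a) (rename_p \<pi> X))"
      and \<pi>: "level_preserving \<pi>" and n: "n \<notin> fa_p (rename_p \<pi> (IAll b X))" for b X \<pi>
  proof -
    have "finite {a, n}" by simp
    then obtain c where c: "level c = level (\<pi> b)" "c \<notin> {a, n}"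
      "IAll (\<pi> b) (rename_p \<pi> X) = IAll c (rename_p (swap c (\<pi> b)) (rename_p \<pi> X))"
      "IComp (\<pi> b) (rename_p \<pi> X) = IComp c (rename_p (swap c (\<pi> b)) (rename_p \<pi> X))"
      by (rule ex_fresh_binder)
    have \<pi>': "level_preserving (swap c (\<pi> b) \<circ> \<pi>)"
      by (intro level_preserving_comp level_preserving_swap c \<pi>)
    let ?Y = "rename_p (swap c (\<pi> b) \<circ> \<pi>) X"
    have eq: "rename_p \<pi> (IAll b X) = IAll c ?Y" "rename_s \<pi> (IComp b X) = IComp c ?Y"
      using c \<pi> by (simp_all add: rename_simps level_preserving_level_perm rename_comp level_perm_swap)
    \<comment> \<open>Freshness of \<open>n\<close> passes from the binder to its body because the
      bound atom \<open>c\<close> differs from \<open>n\<close>.\<close>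
    have "n \<notin> fa_p ?Y" using n c(2) unfolding eq by auto
    then have "subst_rel_p a (IAtm n) ?Y (rename_p (swap n a) ?Y)" using IH \<pi>' by blast
    then show ?thesis using eq c(2) by blast
  qed
  {
    case (internal_And \<X>)
    then show ?case
      by (auto simp: rename_simps level_preserving_level_perm lp fset.rel_map
          intro!: subst_And fset.rel_refl_strong)
  next
    case (internal_Not X)
    then show ?case
      by (auto simp: rename_simps level_preserving_level_perm lp intro!: subst_Not)
  next
    case (internal_All X b)
    show ?case
    proof (intro allI impI)
      fix \<pi> assume "level_preserving \<pi>" "n \<notin> fa_p (rename_p \<pi> (IAll b X))"
      from bound[OF internal_All.IH this] obtain c Y where "c \<noteq> a" "c \<noteq> n"
        "rename_p \<pi> (IAll b X) = IAll c Y" "subst_rel_p a (IAtm n) Y (rename_p (swap n a) Y)"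
        by blast
      then show "subst_rel_p a (IAtm n) (rename_p \<pi> (IAll b X))
          (rename_p (swap n a) (rename_p \<pi> (IAll b X)))"
        by (simp add: rename_simps lp subst_All)
    qed
  next
    case (internal_Elt d k y)
    show ?case
    proof (intro allI impI)
      fix \<pi> assume \<pi>: "level_preserving \<pi>" and n: "n \<notin> fa_p (rename_p \<pi> (IElt y d))"
      have eq: "rename_p \<pi> (IElt y d) = IElt (rename_s \<pi> y) (\<pi> d)"
        using \<pi> by (simp add: rename_simps level_preserving_level_perm)
      have "subst_rel_s a (IAtm n) (rename_s \<pi> y) (rename_s (swap n a) (rename_s \<pi> y))"
        using internal_Elt.IH \<pi> n unfolding eq by simp
      \<comment> \<open>At \<open>n\<close> the two operations would disagree: the swapping sends
        \<open>n\<close> to \<open>a\<close>, while the substitution leaves it alone. At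
        \<open>a\<close> both give \<open>n\<close>, and they fix every other atom.\<close>
      moreover have "\<pi> d \<noteq> n" using n unfolding eq by auto
      ultimately show "subst_rel_p a (IAtm n) (rename_p \<pi> (IElt y d))
          (rename_p (swap n a) (rename_p \<pi> (IElt y d)))"
        unfolding eq rename_simps(4)[OF lp]
        by (cases "\<pi> d = a") (simp_all add: subst_Elt_Atm subst_Elt_other)
    qed
  next
    case (internal_Atm b k)
    show ?case
    proof (intro allI impI)
      fix \<pi> assume \<pi>: "level_preserving \<pi>" and n: "n \<notin> fa_s (rename_s \<pi> (IAtm b))"
      have eq: "rename_s \<pi> (IAtm b) = IAtm (\<pi> b)"
        using \<pi> by (simp add: rename_simps level_preserving_level_perm)
      have "\<pi> b \<noteq> n" using n unfolding eq by auto
      then show "subst_rel_s a (IAtm n) (rename_s \<pi> (IAtm b))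
          (rename_s (swap n a) (rename_s \<pi> (IAtm b)))"
        unfolding eq rename_simps(5)[OF lp]
        by (cases "\<pi> b = a") (simp_all add: subst_Atm subst_Atm_other)
    qed
  next
    case (internal_Comp b k X)
    show ?case
    proof (intro allI impI)
      fix \<pi> assume \<pi>: "level_preserving \<pi>" and n: "n \<notin> fa_s (rename_s \<pi> (IComp b X))"
      \<comment> \<open>\<open>bound\<close> states freshness for the quantifier, which has the same
        free atoms as the comprehension.\<close>
      have "n \<notin> fa_p (rename_p \<pi> (IAll b X))"
        using n \<pi> by (simp add: rename_simps level_preserving_level_perm)
      from bound[OF internal_Comp.IH \<pi> this] obtain c Y where "c \<noteq> a" "c \<noteq> n"
        "rename_s \<pi> (IComp b X) = IComp c Y" "subst_rel_p a (IAtm n) Y (rename_p (swap n a) Y)"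
        by blast
      then show "subst_rel_s a (IAtm n) (rename_s \<pi> (IComp b X))
          (rename_s (swap n a) (rename_s \<pi> (IComp b X)))"
        by (simp add: rename_simps lp subst_Comp)
    qed
  }
qed

lemma subst_p_IAtm:
  assumes "internal_pred X" "level n = level a" "n \<noteq> a" "n \<notin> fa_p X"
  shows "subst_p X a (IAtm n) = rename_p (swap n a) X"
  using subst_rel_IAtm_rename(1)[OF assms(2,3,1), rule_format, OF level_preserving_id(1)] assms(4)
  by (simp add: subst_p_eqI)

lemma sat_IAll_imp_sat_subst:
  assumes "a \<in> \<A> i" "internal_pred X" "generously_names p i x" "p \<Turnstile> IAll a X"
  shows "p \<Turnstile> subst_p X a x"
proof (rule ccontr)
  assume not: "\<not> p \<Turnstile> subst_p X a x"
  let ?G = "{a' \<in> \<A> i. p \<Turnstile> rename_p (swap a' a) X \<longleftrightarrow> p \<Turnstile> subst_p X a x}"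
  have "level a = i" using assms(1) by (simp add: \<A>_def)
  then have "small (\<A> i - {a' \<in> \<A> i. p \<Turnstile> rename_p (swap a' a) X})"
    using assms(4) by (simp add: sat_IAll new_atom_def)
  \<comment> \<open>As the substituted predicate fails, \<open>?G\<close> consists of the atoms at
    which the renamed predicate fails too.\<close>
  then have "small ?G" by (rule small_mono) (use not in auto)
  moreover have "generous ?G" using assms(1-3) unfolding generously_names_def by blast
  ultimately show False using not_small_generous by blast
qed

lemma sat_IAll_if_sat_subst_IAtm:
  assumes "internal_pred X"
    and sat: "\<And>n. level n = level a \<Longrightarrow> p \<Turnstile> subst_p X a (IAtm n)"
  shows "p \<Turnstile> IAll a X"
proof -
  \<comment> \<open>Outside this finite set \<open>subst_p_IAtm\<close> identifies the renaming with
    a substitution that \<open>p\<close> validates.\<close>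
  have "\<A> (level a) - {a' \<in> \<A> (level a). p \<Turnstile> rename_p (swap a' a) X} \<subseteq> insert a (fa_p X)"
  proof
    fix n assume n: "n \<in> \<A> (level a) - {a' \<in> \<A> (level a). p \<Turnstile> rename_p (swap a' a) X}"
    then have l: "level n = level a" and "\<not> p \<Turnstile> rename_p (swap n a) X" by (simp_all add: \<A>_def)
    then have "subst_p X a (IAtm n) \<noteq> rename_p (swap n a) X" using sat[OF l] by auto
    then show "n \<in> insert a (fa_p X)" using subst_p_IAtm[OF assms(1) l] by blast
  qed
  then have "small (\<A> (level a) - {a' \<in> \<A> (level a). p \<Turnstile> rename_p (swap a' a) X})"
    by (rule small_finite[OF finite_subset]) simp
  then show ?thesis by (simp add: sat_IAll new_atom_def)
qed

theorem theorem8p15: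
  fixes i :: int and a :: "'a::atoms" and X :: "'a ipred"
  assumes "a \<in> \<A> i" and "internal_pred X"
  shows "points_of (IAll a X) = (\<Inter>x \<in> \<L> i. points_of (subst_p X a x))"
proof
  show "points_of (IAll a X) \<subseteq> (\<Inter>x \<in> \<L> i. points_of (subst_p X a x))"
    unfolding points_of_def point_def using sat_IAll_imp_sat_subst[OF assms] by blast
next
  have atm: "IAtm n \<in> \<L> i" if "level n = level a" for n :: 'a
    using that assms(1) by (simp add: \<L>_def \<A>_def internal_Atm)
  show "(\<Inter>x \<in> \<L> i. points_of (subst_p X a x)) \<subseteq> points_of (IAll a X)"
  proof
    fix p assume p: "p \<in> (\<Inter>x \<in> \<L> i. points_of (subst_p X a x))"
    \<comment> \<open>The witness \<open>IAtm a\<close> shows that the intersection is not over an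
      empty index set, so its members are points.\<close>
    then have "point p" using atm[of a] by (auto simp: points_of_def)
    moreover have "p \<Turnstile> IAll a X"
      using p atm by (intro sat_IAll_if_sat_subst_IAtm assms(2)) (auto simp: points_of_def)
    ultimately show "p \<in> points_of (IAll a X)" by (simp add: points_of_def)
  qed
qed

end
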